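(* In the binary model, suppose $\lambda=1/\theta$ where $\theta$ is a Pisot number. Then almost surely $S$ is disconnected and has no isolated gaps; more precisely, almost surely, for every connected component $(\alpha,\beta)$ of $\mathbb{R}\setminus S$: if $\alpha>-\infty$ then $(\alpha-\varepsilon,\alpha)\not\subset S$ for every $\varepsilon>0$, and if $\beta<\infty$ then $(\beta,\beta+\varepsilon)\not\subset S$ for every $\varepsilon>0$.
   Context: Binary model. Let $T=\{1,2\}^*$ be the set of finite words over $\{1,2\}$ (the rooted binary tree; $v|j$ is the prefix of $v$ of length $j$). Let $\{a_v\}_{v\in T,\,|v|\ge1}$ be i.i.d. random variables with $\mathbb{P}(a_v=0)=\mathbb{P}(a_v=1)=\frac12$. Fix $\lambda\in(0,1)$. For $\omega\in\{1,2\}^{\mathbb{N}}$ put $f(\omega)=\sum_{j\ge1}a_{\omega|j}\lambda^j$. Let $\mu$ be the image under $f$ of the uniform product measure on $\{1,2\}^{\mathbb{N}}$, and $S=f(\{1,2\}^{\mathbb{N}})$ its (random, compact) support. A Pisot number is an algebraic integer $\theta>1$ all of whose Galois conjugates have absolute value strictly less than $1$. *)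

theory Defs
  imports "HOL-Probability.Probability" "HOL-Computational_Algebra.Polynomial"
begin

(* Galois conjugates of an algebraic number x: the complex roots of its minimal
   polynomial, represented (up to sign) by an irreducible integer polynomial with root x. *)
definition galois_conjugates :: "real \<Rightarrow> complex set" where
  "galois_conjugates x = {z. \<exists>p :: int poly. irreducible p \<and> poly (map_poly of_int p) x = 0
                              \<and> poly (map_poly of_int p) z = 0}"

definition pisot :: "real \<Rightarrow> bool" where
  "pisot \<theta> \<longleftrightarrow> algebraic_int \<theta> \<and> \<theta> > 1 \<and>
     (\<forall>z \<in> galois_conjugates \<theta>. z \<noteq> complex_of_real \<theta> \<longrightarrow> cmod z < 1)"

(* Words over {1,2} are encoded as bool lists; an infinite word is a map nat \<Rightarrow> bool.
   The prefix of length j of w is map w [0..<j]. *)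
definition coding_map :: "(bool list \<Rightarrow> real) \<Rightarrow> real \<Rightarrow> (nat \<Rightarrow> bool) \<Rightarrow> real" where
  "coding_map a lam w = (\<Sum>j. a (map w [0..<Suc j]) * lam ^ Suc j)"

definition attractor :: "(bool list \<Rightarrow> real) \<Rightarrow> real \<Rightarrow> real set" where
  "attractor a lam = range (coding_map a lam)"

end

theory Submission
  imports Defs "HOL-Computational_Algebra.Polynomial_Factorial"
    "HOL-Computational_Algebra.Fundamental_Theorem_Algebra"
begin

text \<open>
  Let \<open>f\<^sub>n(v)\<close> be the digit sum of a word \<open>v\<close> of length \<open>n\<close>, and let \<open>r\<close> be a rational number in a gap
  of \<open>S\<close>. Consider the words of length \<open>n\<close> whose digit sum is maximal among the digit sums
  \<open>\<le> r\<close>. For large \<open>n\<close> such a word can be extended without crossing \<open>r\<close>, so as long as one of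
  their children carries the digit 1, the maximal words of the next level are exactly the children
  with digit 1: their number is a critical Galton--Watson process. Critical processes die out, so
  infinitely often all children of the maximal words carry the digit 0 (a reset). Given \<open>u\<close> maximal
  words, a reset has probability \<open>4\<^sup>-\<^sup>u\<close>; that one chosen child carries the digit 1, all others 0, and
  the next \<open>k\<close> generations below the chosen child only the digit 1, has probability \<open>\<delta> 4\<^sup>-\<^sup>u\<close> with
  \<open>\<delta>\<close> depending only on \<open>k\<close>. Hence the second (forced) event also occurs infinitely often.

  As \<open>1/\<lambda>\<close> is a Pisot number, distinct digit sums of level \<open>n\<close> differ by at least a constant times
  \<open>\<lambda>\<^sup>n\<close>. So after a forced event with \<open>k\<close> large, the part of \<open>S\<close> below the chosen child is separated
  from the rest of \<open>S\<close> on its left, which gives holes of \<open>S\<close> arbitrarily close to the left of the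
  gap. Exchanging the digits reflects \<open>S\<close> and gives the other side.
\<close>

section \<open>Separation of digit sums in base a Pisot number\<close>

lemma map_poly_of_int_mult:
  "(map_poly of_int (p * q) :: 'a::comm_ring_1 poly) = map_poly of_int p * map_poly of_int q"
  by (rule poly_eqI) (simp add: coeff_map_poly coeff_mult)

lemma map_poly_of_int_add:
  "(map_poly of_int (p + q) :: 'a::comm_ring_1 poly) = map_poly of_int p + map_poly of_int q"
  by (rule poly_eqI) (simp add: coeff_map_poly)

lemma map_poly_of_int_smult:
  "(map_poly of_int (smult c p) :: 'a::comm_ring_1 poly) = smult (of_int c) (map_poly of_int p)"
  by (rule poly_eqI) (simp add: coeff_map_poly)

lemma map_poly_of_int_minus:
  "(map_poly of_int (- p) :: 'a::comm_ring_1 poly) = - map_poly of_int p"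
  by (rule poly_eqI) (simp add: coeff_map_poly)

lemma map_poly_of_int_pderiv:
  "(map_poly of_int (pderiv p) :: 'a::idom poly) = pderiv (map_poly of_int p)"
  by (rule poly_eqI) (simp add: coeff_map_poly coeff_pderiv)

lemma poly_map_poly_of_int_of_real:
  "poly (map_poly of_int p) (of_real x :: 'a::{real_algebra_1,comm_ring_1}) = of_real (poly (map_poly of_int p) x)"
  by (induction p) (simp_all add: map_poly_pCons)

text \<open>Among the nonzero integer polynomials vanishing at \<open>x\<close>, the primitive part
  of one of least degree is irreducible: in a factorization the factor vanishing at \<open>x\<close>
  has full degree, so the cofactor is a constant dividing the content 1. Being prime, it divides a
  monic polynomial vanishing at \<open>x\<close>, so its leading coefficient is a unit.\<close>

lemma algebraic_int_minimal_polynomial: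
  fixes x :: real
  assumes "algebraic_int x"
  obtains m :: "int poly" where "lead_coeff m = 1" "irreducible m" "poly (map_poly of_int m) x = 0"
    "\<And>p :: int poly. p \<noteq> 0 \<Longrightarrow> poly (map_poly of_int p) x = 0 \<Longrightarrow> degree m \<le> degree p"
proof -
  define Z where "Z p \<longleftrightarrow> poly (map_poly of_int p) x = 0" for p :: "int poly"
  obtain q :: "int poly" where q: "Z q" "lead_coeff q = 1"
    using assms unfolding algebraic_int_altdef_ipoly Z_def by blast
  define P where "P p \<longleftrightarrow> Z p \<and> p \<noteq> 0" for p
  define p1 where "p1 = arg_min degree P"
  have "P q" using q by (auto simp: P_def)
  have p1: "P p1" "\<And>p. P p \<Longrightarrow> degree p1 \<le> degree p"
    unfolding p1_def using \<open>P q\<close> by (auto intro: arg_min_natI arg_min_nat_le)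
  define p0 where "p0 = primitive_part p1"
  have p1eq: "p1 = smult (content p1) p0" by (simp add: p0_def)
  have [simp]: "p1 \<noteq> 0" using p1 by (simp add: P_def)
  have "Z p0"
  proof -
    have "poly (map_poly of_int p1) x = of_int (content p1) * poly (map_poly of_int p0) x"
      by (subst p1eq) (simp add: map_poly_of_int_smult)
    thus ?thesis using p1(1) by (simp add: P_def Z_def)
  qed
  have p0: "p0 \<noteq> 0" "Z p0" "content p0 = 1" using \<open>Z p0\<close> by (simp_all add: p0_def)
  have min: "degree p0 \<le> degree p" if "p \<noteq> 0" "Z p" for p
    using p1(2)[of p] that by (simp add: P_def p0_def)
  have deg: "degree p > 0" if "p \<noteq> 0" "Z p" for p
  proof (rule ccontr)
    assume "\<not> degree p > 0"
    then obtain c where "p = [:c:]" using degree_eq_zeroE by auto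
    with that show False by (simp add: Z_def map_poly_pCons)
  qed
  have unit: "b dvd 1" if "p0 = a * b" "Z a" for a b
  proof -
    have nz: "a \<noteq> 0" "b \<noteq> 0" using that p0 by auto
    have "degree p0 = degree a + degree b" using that nz by (simp add: degree_mult_eq)
    with min[OF nz(1) that(2)] have "degree b = 0" by simp
    then obtain c where c: "b = [:c:]" using degree_eq_zeroE by auto
    hence "[:c:] dvd p0" using that(1) by (metis dvd_triv_right)
    hence "c dvd 1" using const_poly_dvd_iff_dvd_content p0(3) by metis
    thus ?thesis unfolding c by (simp only: is_unit_const_poly_iff)
  qed
  have irr: "irreducible p0"
  proof (rule irreducibleI)
    show "p0 \<noteq> 0" by fact
    show "\<not> p0 dvd 1" using deg[OF p0(1,2)] by (auto simp: is_unit_poly_iff)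
    fix a b assume ab: "p0 = a * b"
    have "Z a \<or> Z b" using p0(2) unfolding ab Z_def by (simp add: map_poly_of_int_mult)
    thus "a dvd 1 \<or> b dvd 1" using unit[OF ab] unit[of b a] ab by (auto simp: mult.commute)
  qed
  hence pr: "prime_elem p0" by (rule irreducible_imp_prime_elem_gcd)
  \<comment> \<open>Pseudo-division stays inside the integer polynomials at the price of the factor
    \<open>a\<close>; the remainder vanishes at \<open>x\<close> and has too small a degree, so it
    is zero.\<close>
  obtain a h where a: "a \<noteq> 0" "smult a q = p0 * h + pseudo_mod q p0"
    using pseudo_mod(1)[OF p0(1), of q] by blast
  have "Z (pseudo_mod q p0)"
  proof -
    have "poly (map_poly of_int (smult a q)) x = 0" using q by (simp add: Z_def map_poly_of_int_smult)
    thus ?thesis using p0(2) unfolding a Z_def by (simp add: map_poly_of_int_add map_poly_of_int_mult)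
  qed
  hence "pseudo_mod q p0 = 0" using pseudo_mod(2)[OF p0(1), of q] min[of "pseudo_mod q p0"] by (meson not_less)
  hence "[:a:] * q = p0 * h" using a by simp
  hence "p0 dvd [:a:] * q" by simp
  hence "p0 dvd [:a:] \<or> p0 dvd q" using pr by (simp only: prime_elem_dvd_mult_iff)
  moreover have "\<not> p0 dvd [:a:]" using dvd_imp_degree_le[of p0 "[:a:]"] deg[OF p0(1,2)] a by auto
  ultimately have "p0 dvd q" by blast
  then obtain h where "q = p0 * h" by (elim dvdE)
  hence "lead_coeff p0 * lead_coeff h = 1" using q by (simp add: lead_coeff_mult)
  hence lc: "lead_coeff p0 = 1 \<or> lead_coeff p0 = -1" by (auto simp: zmult_eq_1_iff)
  show ?thesis
  proof (cases "lead_coeff p0 = 1")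
    case True
    thus ?thesis using that[of p0] irr p0 min by (auto simp: Z_def)
  next
    case False
    with lc have "lead_coeff (-p0) = 1" by simp
    moreover have "irreducible (-p0)"
      using irr by (simp add: irreducible_def)
        (metis dvd_minus_iff minus_dvd_iff minus_equation_iff mult_minus_left)
    ultimately show ?thesis using that[of "-p0"] p0 min by (auto simp: Z_def map_poly_of_int_minus)
  qed
qed

text \<open>The roots of \<open>g\<close> are the other conjugates: \<theta> is a simple root, since
  otherwise \<open>pderiv m\<close> would vanish at it with smaller degree. A zero constant
  coefficient would also allow a smaller degree; that it is nonzero lets the recurrence of
  \<open>m\<close> run backwards.\<close>

lemma pisot_polynomial:
  assumes "pisot \<theta>"
  obtains m :: "int poly" and g :: "complex poly"
  where "lead_coeff m = 1" "coeff m 0 \<noteq> 0" "map_poly of_int m = [:- of_real \<theta>, 1:] * g"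
    "\<And>z. poly g z = 0 \<Longrightarrow> cmod z < 1"
proof -
  have th: "algebraic_int \<theta>" "\<theta> > 1"
    "\<And>z. z \<in> galois_conjugates \<theta> \<Longrightarrow> z \<noteq> of_real \<theta> \<Longrightarrow> cmod z < 1"
    using assms by (auto simp: pisot_def)
  obtain m :: "int poly" where m: "lead_coeff m = 1" "irreducible m" "poly (map_poly of_int m) \<theta> = 0"
    "\<And>p :: int poly. p \<noteq> 0 \<Longrightarrow> poly (map_poly of_int p) \<theta> = 0 \<Longrightarrow> degree m \<le> degree p"
    using algebraic_int_minimal_polynomial[OF th(1)] by blast
  define M :: "complex poly" where "M = map_poly of_int m"
  have "poly M (of_real \<theta>) = 0"
    unfolding M_def poly_map_poly_of_int_of_real m(3) by simp
  then obtain g where g: "M = [:- of_real \<theta>, 1:] * g"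
    by (auto simp: poly_eq_0_iff_dvd elim: dvdE)
  have dpos: "degree m > 0"
  proof (rule ccontr)
    assume "\<not> degree m > 0"
    then obtain c where "m = [:c:]" using degree_eq_zeroE by auto
    with m show False by (simp add: map_poly_pCons)
  qed
  show ?thesis
  proof (rule that[OF m(1) _ g[unfolded M_def]])
    show "coeff m 0 \<noteq> 0"
    proof
      assume "coeff m 0 = 0"
      then obtain h where h: "m = pCons 0 h" by (cases m) auto
      have "h \<noteq> 0" using h m(1) by auto
      moreover have "poly (map_poly of_int h) \<theta> = 0"
        using m(3) th(2) unfolding h by (simp add: map_poly_pCons)
      ultimately have "degree m \<le> degree h" by (rule m(4))
      thus False using \<open>h \<noteq> 0\<close> by (simp add: h)
    qed
    fix z assume z: "poly g z = 0"
    show "cmod z < 1"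
    proof (cases "z = of_real \<theta>")
      case False
      have "poly M z = 0" using z by (simp add: g)
      hence "z \<in> galois_conjugates \<theta>"
        using m(2,3) unfolding galois_conjugates_def M_def by blast
      thus ?thesis using th(3) False by blast
    next
      case True
      have "poly (pderiv M) (of_real \<theta>) = poly g (of_real \<theta>)"
        unfolding g pderiv_mult by (simp add: pderiv_pCons)
      hence "poly (map_poly of_int (pderiv m)) (complex_of_real \<theta>) = 0"
        using z True by (simp add: map_poly_of_int_pderiv M_def)
      hence "complex_of_real (poly (map_poly of_int (pderiv m)) \<theta>) = 0"
        by (simp only: poly_map_poly_of_int_of_real)
      hence "poly (map_poly of_int (pderiv m)) \<theta> = 0" by simp
      moreover have "pderiv m \<noteq> 0" using dpos by (simp add: pderiv_eq_0_iff)
      ultimately have "degree m \<le> degree (pderiv m)" by (intro m(4))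
      thus ?thesis using dpos by (simp add: degree_pderiv)
    qed
  qed
qed

text \<open>The polynomial \<open>p\<close>, evaluated at the shift operator \<open>w \<mapsto> (\<lambda>k. w (Suc k))\<close> and applied to \<open>w\<close>.\<close>

definition shift_act :: "'a::comm_ring_1 poly \<Rightarrow> (nat \<Rightarrow> 'a) \<Rightarrow> nat \<Rightarrow> 'a" where
  "shift_act p w k = (\<Sum>i\<le>degree p. coeff p i * w (k + i))"

lemma shift_act_bound:
  assumes "degree p \<le> n"
  shows "shift_act p w k = (\<Sum>i\<le>n. coeff p i * w (k + i))"
  unfolding shift_act_def using assms
  by (intro sum.mono_neutral_left) (auto simp: coeff_eq_0)

text \<open>A linear factor acts as a first-order difference, so the roots of a recurrence can be
  removed one at a time.\<close>

lemma shift_act_linear_factor: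
  "shift_act ([:- z, 1:] * h) w k = shift_act h (\<lambda>k. w (Suc k) - z * w k) k"
proof -
  define n where "n = degree h"
  have cf: "coeff ([:- z, 1:] * h) i = (case i of 0 \<Rightarrow> 0 | Suc j \<Rightarrow> coeff h j) - z * coeff h i" for i
    by (simp add: coeff_pCons split: nat.splits)
  have "degree ([:- z, 1:] * h) \<le> Suc n"
    using degree_mult_le[of "[:- z, 1:]" h] by (auto simp: n_def intro: order.trans)
  hence "shift_act ([:- z, 1:] * h) w k = (\<Sum>i\<le>Suc n. coeff ([:- z, 1:] * h) i * w (k + i))"
    by (rule shift_act_bound)
  also have "\<dots> = (\<Sum>i\<le>Suc n. (case i of 0 \<Rightarrow> 0 | Suc j \<Rightarrow> coeff h j) * w (k + i))
      - z * (\<Sum>i\<le>Suc n. coeff h i * w (k + i))"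
    by (simp only: cf left_diff_distrib sum_subtractf sum_distrib_left mult.assoc)
  also have "(\<Sum>i\<le>Suc n. (case i of 0 \<Rightarrow> 0 | Suc j \<Rightarrow> coeff h j) * w (k + i))
      = (\<Sum>i\<le>n. coeff h i * w (Suc (k + i)))"
    by (subst sum.atMost_Suc_shift) simp
  also have "(\<Sum>i\<le>Suc n. coeff h i * w (k + i)) = (\<Sum>i\<le>n. coeff h i * w (k + i))"
    by (simp add: n_def coeff_eq_0)
  finally show ?thesis
    by (simp add: shift_act_def n_def right_diff_distrib sum_subtractf sum_distrib_left mult_ac)
qed

lemma first_order_recurrence_decay:
  fixes w :: "nat \<Rightarrow> complex"
  assumes "cmod z < 1" "0 < \<rho>" "\<rho> < 1" "\<And>k. cmod (w (Suc k) - z * w k) \<le> C * \<rho> ^ k"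
  shows "\<exists>C \<rho>. 0 < \<rho> \<and> \<rho> < 1 \<and> (\<forall>k. cmod (w k) \<le> C * \<rho> ^ k)"
proof -
  define r where "r = (max (cmod z) \<rho> + 1) / 2"
  have r: "r < 1" "r > cmod z" "r > \<rho>" "r > 0" using assms by (auto simp: r_def max_def)
  have "C \<ge> 0" using assms(4)[of 0] by (simp add: norm_ge_zero order_trans[OF norm_ge_zero])
  \<comment> \<open>\<open>D\<close> is so large that \<open>C + cmod z * D \<le> D * r\<close>,
    which is what the inductive step needs.\<close>
  define D where "D = max (cmod (w 0)) (C / (r - cmod z))"
  have D: "cmod (w 0) \<le> D" "C \<le> D * (r - cmod z)"
    using r by (auto simp: D_def max_def field_simps)
  have "cmod (w k) \<le> D * r ^ k" for k
  proof (induction k)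
    case 0
    show ?case using D by simp
  next
    case (Suc k)
    have "cmod (w (Suc k)) = cmod (w (Suc k) - z * w k + z * w k)" by simp
    also have "\<dots> \<le> C * \<rho> ^ k + cmod z * cmod (w k)"
      using norm_triangle_ineq[of "w (Suc k) - z * w k" "z * w k"] assms(4)[of k] by (simp add: norm_mult)
    also have "\<dots> \<le> C * r ^ k + cmod z * (D * r ^ k)"
      using Suc \<open>C \<ge> 0\<close> r assms by (intro add_mono mult_left_mono power_mono) auto
    also have "\<dots> = (C + cmod z * D) * r ^ k" by (simp add: algebra_simps)
    also have "\<dots> \<le> (D * r) * r ^ k"
      using D r by (intro mult_right_mono) (auto simp: algebra_simps)
    finally show ?case by (simp add: mult_ac)
  qed
  with r show ?thesis by blast
qed

text \<open>Induction on the degree: after splitting off a root \<open>z\<close>, the differences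
  obey the recurrence of the cofactor up to the same error, and
  \<open>first_order_recurrence_decay\<close> recovers \<open>w\<close> from them.\<close>

lemma recurrence_decay:
  fixes g :: "complex poly" and w :: "nat \<Rightarrow> complex"
  assumes "g \<noteq> 0" "\<And>z. poly g z = 0 \<Longrightarrow> cmod z < 1"
    and "0 < \<rho>" "\<rho> < 1" "\<And>k. cmod (shift_act g w k) \<le> C * \<rho> ^ k"
  shows "\<exists>C \<rho>. 0 < \<rho> \<and> \<rho> < 1 \<and> (\<forall>k. cmod (w k) \<le> C * \<rho> ^ k)"
  using assms
proof (induction "degree g" arbitrary: g w C \<rho>)
  case 0
  then obtain c where c: "g = [:c:]" using degree_eq_zeroE by metis
  hence "c \<noteq> 0" using 0 by auto
  have "cmod (w k) \<le> (C / cmod c) * \<rho> ^ k" for k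
    using 0(6)[of k] \<open>c \<noteq> 0\<close> by (simp add: c shift_act_def norm_mult field_simps)
  thus ?case using 0 by blast
next
  case (Suc n)
  have "\<not> constant (poly g)" using Suc(2) by (simp add: constant_degree)
  then obtain z where z: "poly g z = 0" using fundamental_theorem_of_algebra by blast
  then obtain h where h: "g = [:- z, 1:] * h" by (auto simp: poly_eq_0_iff_dvd elim: dvdE)
  have "h \<noteq> 0" using Suc(3) h by auto
  have "degree g = Suc (degree h)" unfolding h using \<open>h \<noteq> 0\<close> by (subst degree_mult_eq) auto
  hence "n = degree h" using Suc(2) by simp
  have "\<exists>C \<rho>. 0 < \<rho> \<and> \<rho> < 1 \<and> (\<forall>k. cmod (w (Suc k) - z * w k) \<le> C * \<rho> ^ k)"
  proof (rule Suc(1)[OF \<open>n = degree h\<close> \<open>h \<noteq> 0\<close> _ Suc(5,6)])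
    show "cmod y < 1" if "poly h y = 0" for y using Suc(4)[of y] that by (simp add: h)
    show "cmod (shift_act h (\<lambda>k. w (Suc k) - z * w k) k) \<le> C * \<rho> ^ k" for k
      using Suc(7)[of k] by (simp add: h shift_act_linear_factor del: mult_pCons_left)
  qed
  then obtain C' \<rho>' where "0 < \<rho>'" "\<rho>' < 1" "\<And>k. cmod (w (Suc k) - z * w k) \<le> C' * \<rho>' ^ k"
    by blast
  with Suc(4)[OF z] show ?case by (intro first_order_recurrence_decay)
qed

text \<open>The solution of the recurrence \<open>m\<close> with initial values 0, ..., 0, 1; the 1
  shows that it is not the zero sequence when \<open>degree m > 0\<close>.\<close>

function impulse_seq :: "int poly \<Rightarrow> nat \<Rightarrow> int" where
  "impulse_seq m n = (if Suc n < degree m then 0 else if Suc n = degree m then 1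
     else - (\<Sum>i<degree m. coeff m i * impulse_seq m (n - degree m + i)))"
  by auto
termination
  by (relation "Wellfounded.measure snd") auto

declare impulse_seq.simps [simp del]

lemma impulse_seq_recurrence:
  assumes "lead_coeff m = 1"
  shows "shift_act m (impulse_seq m) k = 0"
proof -
  have "impulse_seq m (k + degree m) = - (\<Sum>i<degree m. coeff m i * impulse_seq m (k + i))"
    by (subst impulse_seq.simps) simp
  thus ?thesis using assms
    by (simp add: shift_act_def lessThan_Suc_atMost[symmetric])
qed

lemma monic_recurrence_zero_forward:
  fixes z :: "nat \<Rightarrow> int"
  assumes "lead_coeff m = 1" "\<And>k. shift_act m z k = 0"
    and "\<And>k. k0 \<le> k \<Longrightarrow> k < k0 + degree m \<Longrightarrow> z k = 0"
  shows "k0 \<le> k \<Longrightarrow> z k = 0"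
proof (induction k rule: less_induct)
  case (less k)
  show ?case
  proof (cases "k < k0 + degree m")
    case True
    with less assms(3) show ?thesis by blast
  next
    case False
    define j where "j = k - degree m"
    have j: "k = j + degree m" "k0 \<le> j" using False by (auto simp: j_def)
    have "z (j + i) = 0" if "i < degree m" for i
      using that j less.IH[of "j + i"] by auto
    thus ?thesis using assms(2)[of j] assms(1) j
      by (simp add: shift_act_def lessThan_Suc_atMost[symmetric])
  qed
qed

text \<open>A nonzero constant coefficient lets each term be recovered from the later ones.\<close>

lemma recurrence_zero_backward:
  fixes z :: "nat \<Rightarrow> int"
  assumes "coeff m 0 \<noteq> 0" "\<And>k. shift_act m z k = 0" "\<And>k. k0 \<le> k \<Longrightarrow> z k = 0"
  shows "z k = 0"
proof (induction "k0 - k" arbitrary: k rule: less_induct)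
  case less
  show ?case
  proof (cases "k0 \<le> k")
    case True
    thus ?thesis using assms(3) by blast
  next
    case False
    have "z (k + Suc i) = 0" for i
      using False by (intro less) auto
    hence "(\<Sum>i\<le>degree m. coeff m i * z (k + i)) = coeff m 0 * z k"
      by (subst sum.atMost_shift) simp
    thus ?thesis using assms(1) assms(2)[of k] by (simp add: shift_act_def)
  qed
qed

text \<open>\<open>A\<close> is the limit of \<open>s k / \<theta> ^ k\<close>: the increments are
  dominated by a geometric series of ratio \<open>\<rho> / \<theta>\<close>, and its tail from
  \<open>k\<close> on, multiplied by \<open>\<theta> ^ k\<close>, is of order
  \<open>\<rho> ^ k\<close>.\<close>

lemma geometric_perturbation_asymptotics:
  fixes s :: "nat \<Rightarrow> real"
  assumes th: "\<theta> > 1" and r: "0 < \<rho>" "\<rho> < 1" and w: "\<And>k. \<bar>s (Suc k) - \<theta> * s k\<bar> \<le> C * \<rho> ^ k"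
  obtains A D where "\<And>k. \<bar>s k - A * \<theta> ^ k\<bar> \<le> D * \<rho> ^ k"
proof -
  define u where "u k = s k / \<theta> ^ k" for k
  define x where "x = \<rho> / \<theta>"
  have x: "0 < x" "x < 1" using th r by (auto simp: x_def)
  have C0: "C \<ge> 0" using w[of 0] by auto
  have du: "\<bar>u (Suc k) - u k\<bar> \<le> C * x ^ k" for k
  proof -
    have "u (Suc k) - u k = (s (Suc k) - \<theta> * s k) / \<theta> ^ Suc k"
      using th by (simp add: u_def field_simps)
    hence "\<bar>u (Suc k) - u k\<bar> = \<bar>s (Suc k) - \<theta> * s k\<bar> / \<theta> ^ Suc k"
      using th by (simp add: abs_mult)
    also have "\<dots> \<le> C * \<rho> ^ k / \<theta> ^ Suc k" using w[of k] th by (intro divide_right_mono) auto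
    also have "\<dots> \<le> C * \<rho> ^ k / \<theta> ^ k" using th C0 r by (intro divide_left_mono) (auto simp: mult_le_cancel_right2)
    finally show ?thesis by (simp add: x_def power_divide)
  qed
  have sm: "summable (\<lambda>k. C * x ^ k)" using x by (intro summable_mult summable_geometric) auto
  have sd: "summable (\<lambda>k. u (Suc k) - u k)"
    by (rule summable_comparison_test'[OF sm, of 0]) (use du in auto)
  define A where "A = u 0 + (\<Sum>k. u (Suc k) - u k)"
  have "\<bar>s k - A * \<theta> ^ k\<bar> \<le> (C / (1 - x)) * \<rho> ^ k" for k
  proof -
    have "(\<Sum>k. u (Suc k) - u k) = (\<Sum>n. u (Suc (n + k)) - u (n + k)) + (\<Sum>i<k. u (Suc i) - u i)"
      using suminf_split_initial_segment[OF sd] .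
    hence eq: "A - u k = (\<Sum>n. u (Suc (n + k)) - u (n + k))"
      by (simp add: A_def sum_lessThan_telescope)
    have sm': "summable (\<lambda>n. C * x ^ k * x ^ n)" using x by (intro summable_mult summable_geometric) auto
    have b: "norm (u (Suc (n + k)) - u (n + k)) \<le> C * x ^ k * x ^ n" for n
      using du[of "n + k"] by (simp add: power_add mult_ac)
    have "\<bar>A - u k\<bar> \<le> (\<Sum>n. C * x ^ k * x ^ n)"
      unfolding eq using norm_suminf_le[OF b sm'] by simp
    also have "\<dots> = C * x ^ k / (1 - x)" using x by (simp add: suminf_mult suminf_geometric)
    finally have "\<bar>A - u k\<bar> * \<theta> ^ k \<le> C * x ^ k / (1 - x) * \<theta> ^ k" using th by (intro mult_right_mono) auto
    moreover have "\<bar>A - u k\<bar> * \<theta> ^ k = \<bar>s k - A * \<theta> ^ k\<bar>"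
    proof -
      have "s k - A * \<theta> ^ k = (u k - A) * \<theta> ^ k" using th by (simp add: u_def algebra_simps)
      thus ?thesis using th by (simp add: abs_mult abs_minus_commute)
    qed
    moreover have "x ^ k * \<theta> ^ k = \<rho> ^ k" using th by (simp add: x_def power_divide)
    ultimately show ?thesis by (simp add: mult_ac)
  qed
  thus ?thesis using that by blast
qed

lemma shift_act_commute:
  "shift_act p (shift_act q w) k = shift_act q (shift_act p w) k"
  unfolding shift_act_def sum_distrib_left
  by (subst sum.swap) (simp add: mult_ac add_ac)

text \<open>Let \<open>m\<close> be the minimal polynomial and \<open>s\<close> an integer sequence with recurrence \<open>m\<close>, so that
  \<open>s k = A * \<theta> ^ k + O(\<rho> ^ k)\<close>. Then the integer sequence \<open>z = shift_act P s\<close> satisfies the same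
  recurrence and \<open>z k = A * P(\<theta>) * \<theta> ^ k + O(\<rho> ^ k)\<close> with an error bound independent of \<open>P\<close>.
  If \<open>P(\<theta>)\<close> is small, \<open>degree m\<close> consecutive terms of \<open>z\<close> have absolute value below 1, so \<open>z\<close>
  eventually vanishes and \<open>P(\<theta>) = 0\<close>.\<close>

lemma pisot_separation:
  assumes "pisot \<theta>"
  obtains \<epsilon> where "\<epsilon> > 0" "\<And>P :: int poly. (\<And>i. \<bar>coeff P i\<bar> \<le> 1) \<Longrightarrow> poly (map_poly of_int P) \<theta> \<noteq> 0
    \<Longrightarrow> \<bar>poly (map_poly of_int P) \<theta>\<bar> \<ge> \<epsilon>"
proof -
  have th: "\<theta> > 1" using assms by (auto simp: pisot_def)
  obtain m :: "int poly" and g where m: "lead_coeff m = 1" "coeff m 0 \<noteq> 0"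
    "map_poly of_int m = [:- of_real \<theta>, 1:] * g" "\<And>z. poly g z = 0 \<Longrightarrow> cmod z < 1"
    using pisot_polynomial[OF assms] by metis
  define d where "d = degree m"
  define s where "s = impulse_seq m"
  have sm: "shift_act m s k = 0" for k unfolding s_def by (rule impulse_seq_recurrence[OF m(1)])
  \<comment> \<open>Removing the factor that belongs to \<theta> leaves the recurrence
    \<open>g\<close>, whose roots all lie in the open unit disc.\<close>
  have "shift_act g (\<lambda>k. of_int (s (Suc k)) - of_real \<theta> * of_int (s k)) k = 0" for k
  proof -
    have "shift_act g (\<lambda>k. of_int (s (Suc k)) - of_real \<theta> * of_int (s k)) k
        = shift_act (map_poly of_int m :: complex poly) (\<lambda>k. of_int (s k)) k"
      unfolding m(3) by (rule shift_act_linear_factor[symmetric])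
    also have "\<dots> = of_int (shift_act m s k)"
      unfolding shift_act_def by (simp add: coeff_map_poly degree_map_poly)
    finally show ?thesis by (simp add: sm)
  qed
  moreover have "g \<noteq> 0"
  proof
    assume "g = 0"
    hence "(map_poly of_int m :: complex poly) = 0" using m(3) by simp
    hence "coeff (map_poly of_int m :: complex poly) 0 = 0" by simp
    thus False using m(2) by (simp add: coeff_map_poly)
  qed
  ultimately obtain C \<rho> where r: "0 < \<rho>" "\<rho> < 1"
    and C: "\<And>k. cmod (of_int (s (Suc k)) - of_real \<theta> * of_int (s k)) \<le> C * \<rho> ^ k"
    using recurrence_decay[of g "1/2" "\<lambda>k. of_int (s (Suc k)) - of_real \<theta> * of_int (s k)" 0] m(4)
    by auto
  have C': "\<bar>real_of_int (s (Suc k)) - \<theta> * real_of_int (s k)\<bar> \<le> C * \<rho> ^ k" for k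
  proof -
    have "(of_int (s (Suc k)) - of_real \<theta> * of_int (s k) :: complex)
       = of_real (real_of_int (s (Suc k)) - \<theta> * real_of_int (s k))" by simp
    thus ?thesis using C[of k] by (metis norm_of_real)
  qed
  obtain A D where AD: "\<And>k. \<bar>real_of_int (s k) - A * \<theta> ^ k\<bar> \<le> D * \<rho> ^ k"
    using geometric_perturbation_asymptotics[of \<theta> \<rho> "\<lambda>k. real_of_int (s k)" C] th r C' by blast
  have D0: "D \<ge> 0" using AD[of 0] by auto
  \<comment> \<open>Otherwise the integers \<open>s k\<close> tend to 0, hence vanish from some
    index on and, running backwards, everywhere, against the initial value 1.\<close>
  have "A \<noteq> 0"
  proof
    assume A: "A = 0"
    have "(\<lambda>k. D * \<rho> ^ k) \<longlonglongrightarrow> D * 0" using r by (intro tendsto_mult tendsto_const LIMSEQ_power_zero) auto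
    hence "eventually (\<lambda>k. D * \<rho> ^ k < 1) sequentially" by (rule order_tendstoD) auto
    then obtain k0 where "\<And>k. k \<ge> k0 \<Longrightarrow> D * \<rho> ^ k < 1" by (auto simp: eventually_sequentially)
    hence "\<bar>real_of_int (s k)\<bar> < 1" if "k \<ge> k0" for k using AD[of k] that A by fastforce
    hence "s k = 0" if "k \<ge> k0" for k using that by (metis of_int_abs of_int_less_1_iff zabs_less_one_iff)
    hence s0: "s k = 0" for k using recurrence_zero_backward[OF m(2) sm, of k0] by blast
    show False
    proof (cases "degree m")
      case 0
      thus False using m(3) \<open>g \<noteq> 0\<close> degree_mult_eq[of "[:- of_real \<theta>, 1:]" g]
        by (metis (no_types, lifting) degree_map_poly add_is_0 degree_pCons_eq_if of_int_eq_0_iff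
            one_neq_zero pCons_eq_0_iff zero_neq_one nat.distinct(1))
    next
      case (Suc n)
      have "s n = 1" unfolding s_def by (subst impulse_seq.simps) (simp add: Suc)
      thus False using s0[of n] by simp
    qed
  qed
  \<comment> \<open>Coefficients bounded by 1 let the errors \<open>D * \<rho> ^ (k + j)\<close> add
    up to at most \<open>E * \<rho> ^ k\<close>, whatever the degree of \<open>P\<close>.\<close>
  define E where "E = D / (1 - \<rho>)"
  have E0: "E \<ge> 0" using D0 r by (simp add: E_def)
  have "(\<lambda>k. E * \<rho> ^ k) \<longlonglongrightarrow> E * 0" using r by (intro tendsto_mult tendsto_const LIMSEQ_power_zero) auto
  hence "eventually (\<lambda>k. E * \<rho> ^ k < 1/2) sequentially" by (rule order_tendstoD) auto
  then obtain k0 where k0: "\<And>k. k \<ge> k0 \<Longrightarrow> E * \<rho> ^ k < 1/2" by (auto simp: eventually_sequentially)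
  \<comment> \<open>Makes the main term smaller than 1/2 on the whole window of
    \<open>degree m\<close> indices from \<open>k0\<close>; with an error below 1/2 the integers
    there are 0.\<close>
  define \<epsilon> where "\<epsilon> = 1 / (2 * \<bar>A\<bar> * \<theta> ^ (k0 + d))"
  have "\<epsilon> > 0" using \<open>A \<noteq> 0\<close> th by (simp add: \<epsilon>_def)
  moreover have "\<bar>poly (map_poly of_int P) \<theta>\<bar> \<ge> \<epsilon>"
    if P: "\<And>i. \<bar>coeff P i\<bar> \<le> 1" and nz: "poly (map_poly of_int P) \<theta> \<noteq> 0" for P :: "int poly"
  proof (rule ccontr)
    define y where "y = poly (map_poly of_int P) \<theta>"
    assume "\<not> \<bar>poly (map_poly of_int P) \<theta>\<bar> \<ge> \<epsilon>"
    hence y: "\<bar>y\<bar> < \<epsilon>" "y \<noteq> 0" using nz by (auto simp: y_def)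
    have y_eq: "y = (\<Sum>j\<le>degree P. of_int (coeff P j) * \<theta> ^ j)"
      unfolding y_def by (simp add: poly_altdef degree_map_poly coeff_map_poly)
    define z where "z = shift_act P s"
    have zm: "shift_act m z k = 0" for k
      unfolding z_def shift_act_commute[of m] sm by (simp add: shift_act_def sm)
    have z_bound: "\<bar>of_int (z k) - A * y * \<theta> ^ k\<bar> \<le> E * \<rho> ^ k" for k
    proof -
      have "of_int (z k) - A * y * \<theta> ^ k
          = (\<Sum>j\<le>degree P. of_int (coeff P j) * (of_int (s (k + j)) - A * \<theta> ^ (k + j)))"
        unfolding y_eq z_def shift_act_def
        by (simp add: right_diff_distrib sum_subtractf sum_distrib_left sum_distrib_right power_add mult_ac)
      also have "\<bar>\<dots>\<bar> \<le> (\<Sum>j\<le>degree P. D * \<rho> ^ k * \<rho> ^ j)"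
      proof (rule order_trans[OF sum_abs], rule sum_mono)
        fix j
        have "\<bar>real_of_int (coeff P j)\<bar> \<le> 1" using P[of j] by linarith
        hence "\<bar>real_of_int (coeff P j)\<bar> * \<bar>of_int (s (k + j)) - A * \<theta> ^ (k + j)\<bar> \<le> 1 * (D * \<rho> ^ (k + j))"
          using AD[of "k + j"] by (intro mult_mono) auto
        thus "\<bar>of_int (coeff P j) * (of_int (s (k + j)) - A * \<theta> ^ (k + j))\<bar> \<le> D * \<rho> ^ k * \<rho> ^ j"
          by (simp add: abs_mult power_add mult_ac)
      qed
      also have "\<dots> = D * \<rho> ^ k * (\<Sum>j<Suc (degree P). \<rho> ^ j)"
        by (simp add: sum_distrib_left lessThan_Suc_atMost)
      also have "\<dots> \<le> D * \<rho> ^ k * (1 / (1 - \<rho>))"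
      proof (rule mult_left_mono)
        have "(\<Sum>j<Suc (degree P). \<rho> ^ j) = (1 - \<rho> ^ Suc (degree P)) / (1 - \<rho>)"
          using r sum_gp_strict[of \<rho> "Suc (degree P)"] by simp
        also have "\<dots> \<le> 1 / (1 - \<rho>)" using r by (intro divide_right_mono) auto
        finally show "(\<Sum>j<Suc (degree P). \<rho> ^ j) \<le> 1 / (1 - \<rho>)" .
      qed (use D0 r in auto)
      finally show ?thesis by (simp add: E_def mult_ac)
    qed
    have "z k = 0" if "k0 \<le> k" "k < k0 + degree m" for k
    proof -
      have "\<theta> ^ k \<le> \<theta> ^ (k0 + d)" using th that by (intro power_increasing) (auto simp: d_def)
      hence "\<bar>A * y * \<theta> ^ k\<bar> \<le> \<bar>A\<bar> * \<bar>y\<bar> * \<theta> ^ (k0 + d)"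
        using th by (auto simp: abs_mult intro!: mult_left_mono)
      also have "\<dots> < \<bar>A\<bar> * \<epsilon> * \<theta> ^ (k0 + d)"
        using y \<open>A \<noteq> 0\<close> th by (intro mult_strict_right_mono mult_strict_left_mono) auto
      also have "\<dots> = 1/2" using \<open>A \<noteq> 0\<close> th by (simp add: \<epsilon>_def)
      finally have "\<bar>real_of_int (z k)\<bar> < 1" using z_bound[of k] k0[OF that(1)] by linarith
      thus ?thesis by (metis of_int_abs of_int_less_1_iff zabs_less_one_iff)
    qed
    hence z0: "z k = 0" if "k0 \<le> k" for k
      using monic_recurrence_zero_forward[OF m(1) zm, of k0 k] that by blast
    \<comment> \<open>As \<open>z\<close> vanishes from \<open>k0\<close> on, \<open>z_bound\<close>
      keeps the growing main term below a bounded error, which is absurd for large indices.\<close>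
    have Ay: "\<bar>A * y\<bar> > 0" using \<open>A \<noteq> 0\<close> y by simp
    obtain n where n: "E / \<bar>A * y\<bar> < \<theta> ^ n" using real_arch_pow[OF th] by blast
    have "E < \<bar>A * y\<bar> * \<theta> ^ n" using n Ay by (simp add: field_simps)
    also have "\<dots> \<le> \<bar>A * y\<bar> * \<theta> ^ (n + k0)"
      using th by (intro mult_left_mono power_increasing) auto
    also have "\<dots> \<le> E * \<rho> ^ (n + k0)" using z_bound[of "n + k0"] z0[of "n + k0"] th by (simp add: abs_mult)
    also have "\<dots> \<le> E * 1" using E0 r by (intro mult_left_mono power_le_one) auto
    finally show False by simp
  qed
  ultimately show ?thesis using that by blast
qed

section \<open>Independent fair bits\<close>

text \<open>Stands in for measurability with respect to the bits indexed by \<open>A\<close>; for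
  finite \<open>A\<close>, expectations become finite sums over the patterns on
  \<open>A\<close>.\<close>

definition depends_on :: "'i set \<Rightarrow> (('i \<Rightarrow> bool) \<Rightarrow> 'b) \<Rightarrow> bool" where
  "depends_on A g \<longleftrightarrow> (\<forall>c c'. (\<forall>v\<in>A. c v = c' v) \<longrightarrow> g c = g c')"

lemma depends_onI: "(\<And>c c'. (\<And>v. v \<in> A \<Longrightarrow> c v = c' v) \<Longrightarrow> g c = g c') \<Longrightarrow> depends_on A g"
  unfolding depends_on_def by blast

lemma depends_onD: "depends_on A g \<Longrightarrow> (\<And>v. v \<in> A \<Longrightarrow> c v = c' v) \<Longrightarrow> g c = g c'"
  unfolding depends_on_def by blast

lemma depends_on_mono: "depends_on A g \<Longrightarrow> A \<subseteq> B \<Longrightarrow> depends_on B g"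
  unfolding depends_on_def by blast

lemma depends_on_const [simp]: "depends_on A (\<lambda>_. k)"
  by (simp add: depends_on_def)

lemma depends_on_comp2:
  assumes "depends_on A f" "depends_on A g"
  shows "depends_on A (\<lambda>c. h (f c) (g c))"
  using depends_onD[OF assms(1)] depends_onD[OF assms(2)] by (intro depends_onI) metis

lemma depends_on_comp: "depends_on A f \<Longrightarrow> depends_on A (\<lambda>c. h (f c))"
  by (rule depends_on_comp2[of A f f "\<lambda>x _. h x"])

text \<open>Independent fair bits described through finite cylinders, \<open>C\<close> being the set
  of indices whose bit is true. This form is preserved by flipping all bits.\<close>

locale fair_bits = prob_space M for M :: "'w measure" +
  fixes I :: "'i set" and b :: "'i \<Rightarrow> 'w \<Rightarrow> bool"
  assumes cyl_events: "finite A \<Longrightarrow> A \<subseteq> I \<Longrightarrow> C \<subseteq> A \<Longrightarrow> {x \<in> space M. \<forall>v\<in>A. b v x \<longleftrightarrow> v \<in> C} \<in> events"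
    and prob_cyl: "finite A \<Longrightarrow> A \<subseteq> I \<Longrightarrow> C \<subseteq> A \<Longrightarrow> prob {x \<in> space M. \<forall>v\<in>A. b v x \<longleftrightarrow> v \<in> C} = (1/2) ^ card A"
begin

abbreviation bits :: "'w \<Rightarrow> 'i \<Rightarrow> bool" where "bits x \<equiv> (\<lambda>v. b v x)"

abbreviation cyl :: "'i set \<Rightarrow> 'i set \<Rightarrow> 'w set" where
  "cyl A C \<equiv> {x \<in> space M. \<forall>v\<in>A. b v x \<longleftrightarrow> v \<in> C}"

lemma sum_cyl:
  fixes f :: "'i set \<Rightarrow> real"
  assumes "finite A" "x \<in> space M"
  shows "(\<Sum>C\<in>Pow A. f C * indicator (cyl A C) x) = f {v\<in>A. b v x}"
proof -
  have "indicator (cyl A C) x = (if C = {v\<in>A. b v x} then 1 else (0::real))" if "C \<in> Pow A" for C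
    using assms(2) that by (auto simp: indicator_def)
  hence "(\<Sum>C\<in>Pow A. f C * indicator (cyl A C) x) = (\<Sum>C\<in>Pow A. if C = {v\<in>A. b v x} then f C else 0)"
    by (intro sum.cong) auto
  also have "\<dots> = f {v\<in>A. b v x}" using assms(1) by (simp add: sum.delta)
  finally show ?thesis .
qed

lemma bits_restrict:
  assumes "depends_on A g"
  shows "g (\<lambda>v. v \<in> {v\<in>A. b v x}) = g (bits x)"
  by (rule depends_onD[OF assms]) auto

text \<open>\<open>K\<close> is a finite set of fresh indices selected after looking at the bits in
  \<open>A\<close>, and \<open>T\<close> prescribes the values there. On each pattern
  \<open>C\<close> over \<open>A\<close> both are fixed, so the event becomes a cylinder over a
  larger index set.\<close>

lemma
  fixes g :: "('i \<Rightarrow> bool) \<Rightarrow> real"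
  assumes A: "finite A" "A \<subseteq> I" and g: "depends_on A g"
    and K: "depends_on A K" "\<And>c. finite (K c)" "\<And>c. K c \<subseteq> I - A" and T: "depends_on A T"
  shows integrable_conditional: "integrable M (\<lambda>x. g (bits x) * of_bool (\<forall>y\<in>K (bits x). b y x \<longleftrightarrow> y \<in> T (bits x)))"
    and expectation_conditional:
      "expectation (\<lambda>x. g (bits x) * of_bool (\<forall>y\<in>K (bits x). b y x \<longleftrightarrow> y \<in> T (bits x)))
         = (\<Sum>C\<in>Pow A. g (\<lambda>v. v \<in> C) * (1/2) ^ card (K (\<lambda>v. v \<in> C))) * (1/2) ^ card A"
proof -
  define A' where "A' C = A \<union> K (\<lambda>v. v \<in> C)" for C
  define C' where "C' C = C \<union> (K (\<lambda>v. v \<in> C) \<inter> T (\<lambda>v. v \<in> C))" for C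
  have A': "finite (A' C)" "A' C \<subseteq> I" "card (A' C) = card A + card (K (\<lambda>v. v \<in> C))" for C
    using A K by (auto simp: A'_def intro!: card_Un_disjoint)
  have C': "C' C \<subseteq> A' C" if "C \<in> Pow A" for C using that by (auto simp: A'_def C'_def)
  have eq: "g (bits x) * of_bool (\<forall>y\<in>K (bits x). b y x \<longleftrightarrow> y \<in> T (bits x))
      = (\<Sum>C\<in>Pow A. g (\<lambda>v. v \<in> C) * indicator (cyl (A' C) (C' C)) x)" if x: "x \<in> space M" for x
  proof -
    have "indicator (cyl (A' C) (C' C)) x
        = of_bool (\<forall>y\<in>K (\<lambda>v. v \<in> C). b y x \<longleftrightarrow> y \<in> T (\<lambda>v. v \<in> C)) * (indicator (cyl A C) x :: real)"
      if "C \<in> Pow A" for C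
    proof -
      have "x \<in> cyl (A' C) (C' C) \<longleftrightarrow>
          x \<in> cyl A C \<and> (\<forall>y\<in>K (\<lambda>v. v \<in> C). b y x \<longleftrightarrow> y \<in> T (\<lambda>v. v \<in> C))"
        using x that K(3)[of "\<lambda>v. v \<in> C"] unfolding A'_def C'_def by blast
      thus ?thesis by (simp add: indicator_def of_bool_def)
    qed
    hence "(\<Sum>C\<in>Pow A. g (\<lambda>v. v \<in> C) * indicator (cyl (A' C) (C' C)) x)
      = (\<Sum>C\<in>Pow A. (g (\<lambda>v. v \<in> C) * of_bool (\<forall>y\<in>K (\<lambda>v. v \<in> C). b y x \<longleftrightarrow> y \<in> T (\<lambda>v. v \<in> C)))
            * indicator (cyl A C) x)"
      by (intro sum.cong) (auto simp: mult_ac)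
    also have "\<dots> = g (bits x) * of_bool (\<forall>y\<in>K (bits x). b y x \<longleftrightarrow> y \<in> T (bits x))"
      by (subst sum_cyl[OF A(1) x]) (simp only: bits_restrict[OF g] bits_restrict[OF K(1)] bits_restrict[OF T])
    finally show ?thesis by simp
  qed
  have int: "integrable M (\<lambda>x. g (\<lambda>v. v \<in> C) * indicator (cyl (A' C) (C' C)) x)" if "C \<in> Pow A" for C
    using cyl_events[OF A'(1,2) C'[OF that]]
    by (intro integrable_mult_right integrable_real_indicator) (auto simp: emeasure_eq_measure)
  have "integrable M (\<lambda>x. \<Sum>C\<in>Pow A. g (\<lambda>v. v \<in> C) * indicator (cyl (A' C) (C' C)) x)"
    by (intro Bochner_Integration.integrable_sum int)
  thus "integrable M (\<lambda>x. g (bits x) * of_bool (\<forall>y\<in>K (bits x). b y x \<longleftrightarrow> y \<in> T (bits x)))"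
    by (subst Bochner_Integration.integrable_cong[OF refl eq]) auto
  have "expectation (\<lambda>x. g (bits x) * of_bool (\<forall>y\<in>K (bits x). b y x \<longleftrightarrow> y \<in> T (bits x)))
      = expectation (\<lambda>x. \<Sum>C\<in>Pow A. g (\<lambda>v. v \<in> C) * indicator (cyl (A' C) (C' C)) x)"
    by (rule Bochner_Integration.integral_cong[OF refl eq])
  also have "\<dots> = (\<Sum>C\<in>Pow A. expectation (\<lambda>x. g (\<lambda>v. v \<in> C) * indicator (cyl (A' C) (C' C)) x))"
    by (rule Bochner_Integration.integral_sum) (rule int)
  also have "\<dots> = (\<Sum>C\<in>Pow A. g (\<lambda>v. v \<in> C) * prob (cyl (A' C) (C' C)))"
    using cyl_events[OF A'(1,2) C'] by (intro sum.cong refl) simp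
  also have "\<dots> = (\<Sum>C\<in>Pow A. g (\<lambda>v. v \<in> C) * (1/2) ^ card (K (\<lambda>v. v \<in> C)) * (1/2) ^ card A)"
    using prob_cyl[OF A'(1,2) C'] by (intro sum.cong refl) (simp add: A'(3) power_add mult_ac)
  finally show "expectation (\<lambda>x. g (bits x) * of_bool (\<forall>y\<in>K (bits x). b y x \<longleftrightarrow> y \<in> T (bits x)))
         = (\<Sum>C\<in>Pow A. g (\<lambda>v. v \<in> C) * (1/2) ^ card (K (\<lambda>v. v \<in> C))) * (1/2) ^ card A"
    by (simp add: sum_distrib_right)
qed

lemma
  fixes g :: "('i \<Rightarrow> bool) \<Rightarrow> real"
  assumes "finite A" "A \<subseteq> I" "depends_on A g"
  shows integrable_bits: "integrable M (\<lambda>x. g (bits x))"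
    and expectation_bits: "expectation (\<lambda>x. g (bits x)) = (\<Sum>C\<in>Pow A. g (\<lambda>v. v \<in> C)) * (1/2) ^ card A"
  using integrable_conditional[OF assms, of "\<lambda>_. {}" "\<lambda>_. {}"] expectation_conditional[OF assms, of "\<lambda>_. {}" "\<lambda>_. {}"]
  by simp_all

text \<open>Conditioning in integrated form: given the bits in \<open>A\<close>, the fresh bits take
  any prescribed values with probability \<open>(1/2) ^ card K\<close>.\<close>

lemma expectation_conditional':
  fixes g :: "('i \<Rightarrow> bool) \<Rightarrow> real"
  assumes "finite A" "A \<subseteq> I" "depends_on A g"
    and "depends_on A K" "\<And>c. finite (K c)" "\<And>c. K c \<subseteq> I - A" and "depends_on A T"
  shows "expectation (\<lambda>x. g (bits x) * of_bool (\<forall>y\<in>K (bits x). b y x \<longleftrightarrow> y \<in> T (bits x)))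
         = expectation (\<lambda>x. g (bits x) * (1/2) ^ card (K (bits x)))"
  unfolding expectation_conditional[OF assms]
  by (rule expectation_bits[OF assms(1,2) depends_on_comp2[OF assms(3,4)], symmetric])

lemma events_bits:
  assumes "finite A" "A \<subseteq> I" "depends_on A P"
  shows "{x \<in> space M. P (bits x)} \<in> events"
proof -
  have "integrable M (\<lambda>x. of_bool (P (bits x)) :: real)"
    by (rule integrable_bits[OF assms(1,2)]) (rule depends_on_comp[OF assms(3)])
  hence "(\<lambda>x. of_bool (P (bits x)) :: real) \<in> borel_measurable M" by auto
  hence "{x \<in> space M. (of_bool (P (bits x)) :: real) = 1} \<in> events" by measurable
  thus ?thesis by simp
qed

lemma prob_bits:
  assumes "finite A" "A \<subseteq> I" "depends_on A P"
  shows "prob {x \<in> space M. P (bits x)} = expectation (\<lambda>x. of_bool (P (bits x)))"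
proof -
  have "prob {x \<in> space M. P (bits x)} = expectation (indicator {x \<in> space M. P (bits x)})"
    using events_bits[OF assms] by simp
  also have "\<dots> = expectation (\<lambda>x. of_bool (P (bits x)))"
    by (intro Bochner_Integration.integral_cong) (auto simp: indicator_def)
  finally show ?thesis .
qed

text \<open>Summing over the patterns \<open>D\<close> on \<open>B\<close> reduces \<open>Q\<close>
  to prescriptions of all bits in \<open>B\<close>, where \<open>expectation_conditional'\<close>
  applies with constant \<open>K\<close> and \<open>T\<close>.\<close>

lemma prob_bits_conj:
  assumes A: "finite A" "A \<subseteq> I" "depends_on A P" and B: "finite B" "B \<subseteq> I" "depends_on B Q"
    and disj: "A \<inter> B = {}"
  shows "prob {x \<in> space M. P (bits x) \<and> Q (bits x)} = prob {x \<in> space M. P (bits x)} * prob {x \<in> space M. Q (bits x)}"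
proof -
  have dB: "depends_on B (\<lambda>c. of_bool (Q c) :: real)" by (rule depends_on_comp[OF B(3)])
  have dA: "depends_on A (\<lambda>c. of_bool (P c) :: real)" by (rule depends_on_comp[OF A(3)])
  have AB: "finite (A \<union> B)" "A \<union> B \<subseteq> I" using A B by auto
  have dep: "depends_on (A \<union> B) (\<lambda>c. P c \<and> Q c)"
    by (rule depends_on_comp2[OF depends_on_mono[OF A(3)] depends_on_mono[OF B(3)]]) auto
  have *: "of_bool (P (bits x) \<and> Q (bits x)) = (\<Sum>D\<in>Pow B. of_bool (Q (\<lambda>v. v \<in> D)) *
      (of_bool (P (bits x)) * of_bool (\<forall>y\<in>B. b y x \<longleftrightarrow> y \<in> D)) :: real)" if x: "x \<in> space M" for x
  proof -
    have "(\<Sum>D\<in>Pow B. of_bool (Q (\<lambda>v. v \<in> D)) * (of_bool (P (bits x)) * of_bool (\<forall>y\<in>B. b y x \<longleftrightarrow> y \<in> D)))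
        = (\<Sum>D\<in>Pow B. (of_bool (Q (\<lambda>v. v \<in> D)) * of_bool (P (bits x))) * indicator (cyl B D) x :: real)"
      using x by (intro sum.cong) (auto simp: indicator_def)
    also have "\<dots> = of_bool (P (bits x) \<and> Q (bits x))"
      by (subst sum_cyl[OF B(1) x]) (simp only: bits_restrict[OF B(3)], auto)
    finally show ?thesis by simp
  qed
  have int: "integrable M (\<lambda>x. of_bool (P (bits x)) * of_bool (\<forall>y\<in>B. b y x \<longleftrightarrow> y \<in> D) :: real)" for D
    by (rule integrable_conditional[OF A(1,2) dA, of "\<lambda>_. B" "\<lambda>_. D"]) (use B(1,2) disj in auto)
  have "prob {x \<in> space M. P (bits x) \<and> Q (bits x)} = expectation (\<lambda>x. of_bool (P (bits x) \<and> Q (bits x)))"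
    by (rule prob_bits[OF AB dep])
  also have "\<dots> = expectation (\<lambda>x. \<Sum>D\<in>Pow B. of_bool (Q (\<lambda>v. v \<in> D)) *
      (of_bool (P (bits x)) * of_bool (\<forall>y\<in>B. b y x \<longleftrightarrow> y \<in> D)))"
    by (rule Bochner_Integration.integral_cong[OF refl *])
  also have "\<dots> = (\<Sum>D\<in>Pow B. expectation (\<lambda>x. of_bool (Q (\<lambda>v. v \<in> D)) *
      (of_bool (P (bits x)) * of_bool (\<forall>y\<in>B. b y x \<longleftrightarrow> y \<in> D))))"
    by (intro Bochner_Integration.integral_sum integrable_mult_right int)
  also have "\<dots> = (\<Sum>D\<in>Pow B. of_bool (Q (\<lambda>v. v \<in> D)) * (expectation (\<lambda>x. of_bool (P (bits x))) * (1/2 :: real) ^ card B))"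
  proof (intro sum.cong refl)
    fix D
    have "expectation (\<lambda>x. of_bool (P (bits x)) * of_bool (\<forall>y\<in>B. b y x \<longleftrightarrow> y \<in> D))
        = expectation (\<lambda>x. of_bool (P (bits x)) * (1/2 :: real) ^ card B)"
      by (rule expectation_conditional'[OF A(1,2) dA, of "\<lambda>_. B" "\<lambda>_. D"]) (use B disj in auto)
    thus "expectation (\<lambda>x. of_bool (Q (\<lambda>v. v \<in> D)) * (of_bool (P (bits x)) * of_bool (\<forall>y\<in>B. b y x \<longleftrightarrow> y \<in> D)))
        = of_bool (Q (\<lambda>v. v \<in> D)) * (expectation (\<lambda>x. of_bool (P (bits x))) * (1/2 :: real) ^ card B)"
      by simp
  qed
  also have "\<dots> = expectation (\<lambda>x. of_bool (P (bits x))) * ((\<Sum>D\<in>Pow B. of_bool (Q (\<lambda>v. v \<in> D))) * (1/2 :: real) ^ card B)"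
    by (simp add: sum_distrib_left sum_distrib_right mult_ac)
  also have "(\<Sum>D\<in>Pow B. of_bool (Q (\<lambda>v. v \<in> D))) * (1/2 :: real) ^ card B = expectation (\<lambda>x. of_bool (Q (bits x)))"
    by (rule expectation_bits[OF B(1,2) dB, symmetric])
  finally show ?thesis by (simp only: prob_bits[OF A] prob_bits[OF B])
qed

lemma prob_bits_not:
  assumes "finite A" "A \<subseteq> I" "depends_on A P"
  shows "prob {x \<in> space M. \<not> P (bits x)} = 1 - prob {x \<in> space M. P (bits x)}"
proof -
  have "{x \<in> space M. \<not> P (bits x)} = space M - {x \<in> space M. P (bits x)}" by auto
  thus ?thesis using prob_compl[OF events_bits[OF assms]] by simp
qed

lemma prob_bit:
  assumes "v \<in> I"
  shows "prob {x \<in> space M. b v x} = 1/2"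
  using prob_cyl[of "{v}" "{v}"] assms by simp

text \<open>The process that is multiplied by \<open>1 + \<delta>\<close> at each occurrence of \<open>R\<close> and killed at the first
  occurrence of \<open>V\<close> is a martingale.\<close>

lemma AE_infinite_imp_occurs:
  fixes A :: "nat \<Rightarrow> 'i set" and R V :: "nat \<Rightarrow> ('i \<Rightarrow> bool) \<Rightarrow> bool" and \<delta> :: real
  assumes A: "\<And>i. finite (A i)" "\<And>i. A i \<subseteq> I" "\<And>i. A i \<subseteq> A (Suc i)"
    and R: "\<And>i. depends_on (A (Suc i)) (R i)" and V: "\<And>i. depends_on (A (Suc i)) (V i)"
    and disj: "\<And>i c. R i c \<Longrightarrow> V i c \<Longrightarrow> False"
    and "\<delta> > 0"
    and VR: "\<And>i g. depends_on (A i) g \<Longrightarrow>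
      expectation (\<lambda>x. g (bits x) * of_bool (V i (bits x))) = \<delta> * expectation (\<lambda>x. g (bits x) * of_bool (R i (bits x)))"
  shows "AE x in M. infinite {i. R i (bits x)} \<longrightarrow> (\<exists>i. V i (bits x))"
proof -
  define Z where "Z i c = (\<Prod>j<i. if V j c then 0 else if R j c then 1 + \<delta> else (1::real))" for i c
  have Z_nonneg: "Z i c \<ge> 0" for i c
    using \<open>\<delta> > 0\<close> unfolding Z_def by (intro prod_nonneg) auto
  have A_mono: "A i \<subseteq> A j" if "i \<le> j" for i j
    using lift_Suc_mono_le[of A, OF A(3) that] .
  have Z_dep: "depends_on (A i) (Z i)" for i
  proof (rule depends_onI)
    fix c c' :: "'i \<Rightarrow> bool" assume eq: "\<And>v. v \<in> A i \<Longrightarrow> c v = c' v"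
    have "R j c = R j c' \<and> V j c = V j c'" if "j < i" for j
      using A_mono[of "Suc j" i] that eq depends_onD[OF R[of j], of c c'] depends_onD[OF V[of j], of c c'] by auto
    thus "Z i c = Z i c'" unfolding Z_def by (intro prod.cong) auto
  qed
  have dep2: "depends_on (A (Suc i)) (\<lambda>c. Z i c * of_bool (R i c))" "depends_on (A (Suc i)) (\<lambda>c. Z i c * of_bool (V i c))" for i
    by (rule depends_on_comp2[OF depends_on_mono[OF Z_dep A(3)] R], rule depends_on_comp2[OF depends_on_mono[OF Z_dep A(3)] V])
  have EZ: "expectation (\<lambda>x. Z i (bits x)) = 1" for i
  proof (induction i)
    case 0
    show ?case by (simp add: Z_def prob_space)
  next
    case (Suc i)
    \<comment> \<open>As \<open>R\<close> and \<open>V\<close> exclude each other, the increment has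
      two separate parts, whose means cancel by \<open>VR\<close>.\<close>
    have "Z (Suc i) c = Z i c + \<delta> * (Z i c * of_bool (R i c)) - Z i c * of_bool (V i c)" for c
      using disj[of i c] by (auto simp: Z_def algebra_simps)
    hence "expectation (\<lambda>x. Z (Suc i) (bits x)) = expectation (\<lambda>x. Z i (bits x) + \<delta> * (Z i (bits x) * of_bool (R i (bits x))) - Z i (bits x) * of_bool (V i (bits x)))"
      by simp
    also have "\<dots> = expectation (\<lambda>x. Z i (bits x)) + \<delta> * expectation (\<lambda>x. Z i (bits x) * of_bool (R i (bits x)))
        - expectation (\<lambda>x. Z i (bits x) * of_bool (V i (bits x)))"
      using integrable_bits[OF A(1,2) Z_dep, of i] integrable_bits[OF A(1,2) dep2(1), of i] integrable_bits[OF A(1,2) dep2(2), of i]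
      by simp
    finally show ?case using VR[OF Z_dep, of i] Suc by simp
  qed
  \<comment> \<open>On \<open>F j m\<close> the process was never killed and was multiplied at least
    \<open>j\<close> times, so its mean 1 bounds the probability by
    \<open>1 / (1 + \<delta>) ^ j\<close>, uniformly in \<open>m\<close>.\<close>
  define F where "F j m = {x \<in> space M. (\<forall>i. \<not> V i (bits x)) \<and> card {i. i < m \<and> R i (bits x)} \<ge> j}" for j m
  have evV: "{x \<in> space M. V i (bits x)} \<in> events" for i by (rule events_bits[OF A(1,2) V])
  have evRc: "{x \<in> space M. card {i. i < m \<and> R i (bits x)} \<ge> j} \<in> events" for j m
  proof (rule events_bits[OF A(1,2), of m])
    show "depends_on (A m) (\<lambda>c. card {i. i < m \<and> R i c} \<ge> j)"
    proof (rule depends_onI)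
      fix c c' :: "'i \<Rightarrow> bool" assume eq: "\<And>v. v \<in> A m \<Longrightarrow> c v = c' v"
      have "R j c = R j c'" if "j < m" for j
        using A_mono[of "Suc j" m] that eq depends_onD[OF R[of j], of c c'] by auto
      hence "{i. i < m \<and> R i c} = {i. i < m \<and> R i c'}" by auto
      thus "(card {i. i < m \<and> R i c} \<ge> j) = (card {i. i < m \<and> R i c'} \<ge> j)" by simp
    qed
  qed
  have F_ev: "F j m \<in> events" for j m
  proof -
    have "F j m = (\<Inter>i. space M - {x \<in> space M. V i (bits x)}) \<inter> {x \<in> space M. card {i. i < m \<and> R i (bits x)} \<ge> j}"
      by (auto simp: F_def)
    also have "\<dots> \<in> events"
      by (intro sets.Int sets.countable_INT image_subsetI sets.Diff sets.top evV evRc UNIV_not_empty)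
    finally show ?thesis .
  qed
  have F_prob: "prob (F j m) \<le> 1 / (1 + \<delta>) ^ j" for j m
  proof -
    have "prob (F j m) = expectation (indicator (F j m))" using F_ev[of j m] by simp
    also have "\<dots> \<le> expectation (\<lambda>x. Z m (bits x) / (1 + \<delta>) ^ j)"
    proof (rule integral_mono)
      show "integrable M (indicator (F j m) :: _ \<Rightarrow> real)" using F_ev[of j m] by (simp add: emeasure_eq_measure)
      show "integrable M (\<lambda>x. Z m (bits x) / (1 + \<delta>) ^ j)" using integrable_bits[OF A(1,2) Z_dep, of m] by simp
      fix x assume "x \<in> space M"
      show "indicator (F j m) x \<le> Z m (bits x) / (1 + \<delta>) ^ j"
      proof (cases "x \<in> F j m")
        case False
        thus ?thesis using Z_nonneg[of m "bits x"] \<open>\<delta> > 0\<close> by simp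
      next
        case True
        hence x: "\<And>i. \<not> V i (bits x)" "card {i. i < m \<and> R i (bits x)} \<ge> j" by (auto simp: F_def)
        have "Z m (bits x) = (\<Prod>j<m. if R j (bits x) then 1 + \<delta> else 1)" using x by (simp add: Z_def)
        also have "\<dots> = (1 + \<delta>) ^ card {i. i < m \<and> R i (bits x)}"
          by (subst prod.If_cases) (auto simp: Int_def intro!: arg_cong[of _ _ card])
        also have "\<dots> \<ge> (1 + \<delta>) ^ j" using x \<open>\<delta> > 0\<close> by (intro power_increasing) auto
        finally show ?thesis using True \<open>\<delta> > 0\<close> by simp
      qed
    qed
    also have "\<dots> = 1 / (1 + \<delta>) ^ j" by (simp add: EZ)
    finally show ?thesis .
  qed
  define N where "N = (\<Inter>j. \<Union>m. F j m)"
  have N_ev: "N \<in> events" unfolding N_def by (intro sets.countable_INT sets.countable_UN image_subsetI F_ev UNIV_not_empty)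
  have "prob N \<le> 1 / (1 + \<delta>) ^ j" for j
  proof -
    have "incseq (F j)"
    proof (rule incseq_SucI)
      fix m
      have "card {i. i < m \<and> R i (bits x)} \<le> card {i. i < Suc m \<and> R i (bits x)}" for x
        by (intro card_mono) auto
      thus "F j m \<le> F j (Suc m)" unfolding F_def using order_trans by fastforce
    qed
    hence "(\<lambda>m. prob (F j m)) \<longlonglongrightarrow> prob (\<Union>m. F j m)"
      using F_ev by (intro finite_Lim_measure_incseq) auto
    hence "prob (\<Union>m. F j m) \<le> 1 / (1 + \<delta>) ^ j" by (rule LIMSEQ_le_const2) (use F_prob in auto)
    moreover have "prob N \<le> prob (\<Union>m. F j m)"
      unfolding N_def by (intro finite_measure_mono sets.countable_UN image_subsetI F_ev INT_lower UNIV_I)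
    ultimately show ?thesis by simp
  qed
  moreover have "(\<lambda>j. 1 / (1 + \<delta>) ^ j) \<longlonglongrightarrow> 0"
    using LIMSEQ_realpow_zero[of "1 / (1 + \<delta>)"] \<open>\<delta> > 0\<close> by (simp add: power_divide)
  ultimately have "prob N \<le> 0" by (intro LIMSEQ_le_const) auto
  hence "emeasure M N = 0" by (simp add: emeasure_eq_measure measure_le_0_iff)
  show ?thesis
  proof (rule AE_I[OF _ \<open>emeasure M N = 0\<close> N_ev])
    show "{x \<in> space M. \<not> (infinite {i. R i (bits x)} \<longrightarrow> (\<exists>i. V i (bits x)))} \<subseteq> N"
    proof (rule subsetI)
      fix x assume "x \<in> {x \<in> space M. \<not> (infinite {i. R i (bits x)} \<longrightarrow> (\<exists>i. V i (bits x)))}"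
      hence x: "x \<in> space M" "infinite {i. R i (bits x)}" "\<nexists>i. V i (bits x)" by blast+
      have "\<exists>m. x \<in> F j m" for j
      proof -
        obtain S where S: "S \<subseteq> {i. R i (bits x)}" "finite S" "card S = j"
          using infinite_arbitrarily_large[OF x(2)] by blast
        have "S \<subseteq> {i. i < Suc (Max S) \<and> R i (bits x)}" using S by (auto simp: less_Suc_eq_le)
        hence "j \<le> card {i. i < Suc (Max S) \<and> R i (bits x)}"
          using S(3) card_mono[of "{i. i < Suc (Max S) \<and> R i (bits x)}" S] by auto
        thus ?thesis using x by (auto simp: F_def)
      qed
      thus "x \<in> N" by (auto simp: N_def)
    qed
  qed
qed

end

section \<open>The attractor near a gap\<close>

text \<open>Digits are read at the prefixes of length 1 up to \<open>length v\<close>; the root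
  carries none.\<close>

definition pos :: "real \<Rightarrow> (bool list \<Rightarrow> bool) \<Rightarrow> bool list \<Rightarrow> real" where
  "pos lam c v = (\<Sum>j<length v. of_bool (c (take (Suc j) v)) * lam ^ Suc j)"

lemma pos_Nil [simp]: "pos lam c [] = 0"
  by (simp add: pos_def)

lemma pos_snoc: "pos lam c (v @ [d]) = pos lam c v + of_bool (c (v @ [d])) * lam ^ Suc (length v)"
  by (simp add: pos_def)

abbreviation pref :: "(nat \<Rightarrow> bool) \<Rightarrow> nat \<Rightarrow> bool list" where
  "pref w n \<equiv> map w [0..<n]"

lemma pref_Suc: "pref w (Suc n) = pref w n @ [w n]"
  by simp

lemma take_pref: "j \<le> n \<Longrightarrow> take j (pref w n) = pref w j"
  by (simp add: take_map)

lemma ex_pref: "\<exists>w. pref w (length v) = v"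
  by (rule exI[of _ "\<lambda>i. v ! i"]) (simp add: map_nth)

text \<open>Survival up to generation \<open>m\<close> of the branching process started at
  \<open>v\<close>, whose individuals are the words with digit 1; the digit of \<open>v\<close>
  itself is not inspected.\<close>

definition survives :: "('a list \<Rightarrow> bool) \<Rightarrow> nat \<Rightarrow> 'a list \<Rightarrow> bool" where
  "survives c m v \<longleftrightarrow> (\<exists>y. length y = m \<and> (\<forall>j<m. c (v @ take (Suc j) y)))"

definition descendants :: "nat \<Rightarrow> 'a list \<Rightarrow> 'a list set" where
  "descendants k v = {v @ y | y. y \<noteq> [] \<and> length y \<le> k}"

lemma survives_mono:
  assumes "survives c m' v" "m \<le> m'"
  shows "survives c m v"
proof -
  obtain y where y: "length y = m'" "\<forall>j<m'. c (v @ take (Suc j) y)" using assms(1) by (auto simp: survives_def)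
  have "c (v @ take (Suc j) (take m y))" if "j < m" for j
    using y(2) that assms(2) by (simp add: min_def)
  thus ?thesis unfolding survives_def using y(1) assms(2) by (intro exI[of _ "take m y"]) auto
qed

locale contraction =
  fixes lam :: real
  assumes lam: "0 < lam" "lam < 1"
begin

text \<open>The sum of \<open>lam ^ j\<close> over \<open>j \<ge> 1\<close>, so that the points
  below a word of length \<open>n\<close> exceed its digit sum by at most
  \<open>L * lam ^ n\<close>.\<close>

definition L :: real where "L = lam / (1 - lam)"

lemma L_pos: "L > 0" using lam by (simp add: L_def)

lemma L_eq: "lam * (1 + L) = L"
  using lam by (simp add: L_def field_simps)

lemma lam_le_L: "lam \<le> L"
proof -
  have "lam * 1 \<le> lam * (1 + L)" using lam L_pos by (intro mult_left_mono) auto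
  thus ?thesis by (simp add: L_eq)
qed

definition pt :: "(bool list \<Rightarrow> bool) \<Rightarrow> (nat \<Rightarrow> bool) \<Rightarrow> real" where
  "pt c w = coding_map (\<lambda>v. of_bool (c v)) lam w"

definition S :: "(bool list \<Rightarrow> bool) \<Rightarrow> real set" where
  "S c = attractor (\<lambda>v. of_bool (c v)) lam"

lemma S_eq: "S c = range (pt c)"
  by (simp add: S_def attractor_def pt_def[abs_def])

lemma sums_geometric_tail: "(\<lambda>j. lam ^ Suc (j + n)) sums (L * lam ^ n)"
proof -
  have "(\<lambda>j. (lam * lam ^ n) * lam ^ j) sums ((lam * lam ^ n) * (1 / (1 - lam)))"
    using lam by (intro sums_mult geometric_sums) auto
  thus ?thesis by (simp add: L_def power_add mult_ac)
qed

lemma summable_pt: "summable (\<lambda>j. of_bool (c (pref w (Suc j))) * lam ^ Suc j)"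
proof (rule summable_comparison_test'[of "\<lambda>j. lam ^ Suc j" 0])
  show "summable (\<lambda>j. lam ^ Suc j)" using sums_geometric_tail[of 0] by (simp add: sums_iff)
qed (use lam in auto)

lemma pos_pref: "pos lam c (pref w n) = (\<Sum>j<n. of_bool (c (pref w (Suc j))) * lam ^ Suc j)"
  unfolding pos_def by (intro sum.cong) (auto simp: take_pref simp del: upt_Suc)

lemma pt_bounds: "pos lam c (pref w n) \<le> pt c w" "pt c w \<le> pos lam c (pref w n) + L * lam ^ n"
proof -
  define f where "f j = of_bool (c (pref w (Suc j))) * lam ^ Suc j" for j
  have sf: "summable f" unfolding f_def by (rule summable_pt)
  have sf': "summable (\<lambda>j. f (j + n))" using sf by (simp add: summable_iff_shift)
  have f: "0 \<le> f j" "f j \<le> lam ^ Suc j" for j using lam by (auto simp: f_def)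
  have "pt c w = (\<Sum>j. f j)" by (simp add: pt_def coding_map_def f_def[abs_def] del: upt_Suc)
  also have "\<dots> = (\<Sum>j. f (j + n)) + (\<Sum>j<n. f j)" by (rule suminf_split_initial_segment[OF sf])
  also have "(\<Sum>j<n. f j) = pos lam c (pref w n)" by (simp only: pos_pref f_def)
  finally have eq: "pt c w = (\<Sum>j. f (j + n)) + pos lam c (pref w n)" .
  have "(\<Sum>j. f (j + n)) \<ge> 0" using sf' f by (intro suminf_nonneg) auto
  moreover have "(\<Sum>j. f (j + n)) \<le> (\<Sum>j. lam ^ Suc (j + n))"
    using sf' f sums_geometric_tail[of n] by (intro suminf_le) (auto simp: sums_iff)
  ultimately show "pos lam c (pref w n) \<le> pt c w" "pt c w \<le> pos lam c (pref w n) + L * lam ^ n"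
    using sums_geometric_tail[of n] eq by (auto simp: sums_iff)
qed

lemma S_bounds: "S c \<subseteq> {0..L}"
  using pt_bounds[of c _ 0] by (auto simp: S_eq)

lemma pt_complement: "pt (\<lambda>v. \<not> c v) w = L - pt c w"
proof -
  have "pt (\<lambda>v. \<not> c v) w = (\<Sum>j. lam ^ Suc j - of_bool (c (pref w (Suc j))) * lam ^ Suc j)"
    unfolding pt_def coding_map_def by (intro suminf_cong) (auto simp del: upt_Suc)
  also have "\<dots> = (\<Sum>j. lam ^ Suc j) - (\<Sum>j. of_bool (c (pref w (Suc j))) * lam ^ Suc j)"
    using sums_geometric_tail[of 0] by (intro suminf_diff[symmetric] summable_pt) (simp add: sums_iff)
  finally show ?thesis
    using sums_geometric_tail[of 0] by (simp add: pt_def coding_map_def sums_iff del: upt_Suc)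
qed

lemma S_complement: "S (\<lambda>v. \<not> c v) = (\<lambda>x. L - x) ` S c"
  by (auto simp: S_eq pt_complement)

lemma lam_power_tendsto: "(\<lambda>n. K * lam ^ n) \<longlonglongrightarrow> 0"
  using lam by (intro tendsto_mult_right_zero LIMSEQ_power_zero) auto

lemma ex_small_power:
  assumes "e > 0"
  shows "\<exists>n0. \<forall>n\<ge>n0. K * lam ^ n < e"
  using order_tendstoD(2)[OF lam_power_tendsto assms, of K] by (simp add: eventually_sequentially)

text \<open>A point of the closure lies in the closure of one of the two halves of each cylinder
  containing it; following these choices gives an infinite word, and the cylinders shrink to its
  point.\<close>

lemma closed_S: "closed (S c)"
proof -
  define Y where "Y v = pt c ` {w. pref w (length v) = v}" for v
  have Y_split: "Y v = Y (v @ [False]) \<union> Y (v @ [True])" for v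
  proof -
    have "{w. pref w (length v) = v} = {w. pref w (length v) @ [w (length v)] = v @ [False]}
        \<union> {w. pref w (length v) @ [w (length v)] = v @ [True]}" by auto
    thus ?thesis by (simp add: Y_def image_Un)
  qed
  have "x \<in> S c" if x: "x \<in> closure (S c)" for x
  proof -
    define step where "step v = (SOME d. x \<in> closure (Y (v @ [d])))" for v
    define V where "V n = ((\<lambda>v. v @ [step v]) ^^ n) []" for n
    have V_Suc: "V (Suc n) = V n @ [step (V n)]" and V_0: "V 0 = []" for n by (simp_all add: V_def)
    have len: "length (V n) = n" for n by (induction n) (simp_all add: V_Suc V_0)
    have V_clos: "x \<in> closure (Y (V n))" for n
    proof (induction n)
      case 0
      show ?case using x by (simp add: V_0 Y_def S_eq)
    next
      case (Suc n)
      hence "\<exists>d. x \<in> closure (Y (V n @ [d]))" unfolding Y_split[of "V n"] by auto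
      thus ?case unfolding V_Suc step_def by (rule someI_ex)
    qed
    define w where "w n = step (V n)" for n
    have pref_w: "pref w n = V n" for n by (induction n) (simp_all add: V_Suc V_0 w_def)
    have "\<bar>x - pt c w\<bar> \<le> L * lam ^ n" for n
    proof -
      have "Y (V n) \<subseteq> cball (pt c w) (L * lam ^ n)"
      proof
        fix y assume "y \<in> Y (V n)"
        then obtain u where u: "y = pt c u" "pref u n = V n" by (auto simp: Y_def len)
        have "\<bar>pt c w - y\<bar> \<le> L * lam ^ n"
          using pt_bounds[of c u n] pt_bounds[of c w n] by (simp add: u pref_w abs_le_iff)
        thus "y \<in> cball (pt c w) (L * lam ^ n)" by (simp add: dist_real_def)
      qed
      hence "closure (Y (V n)) \<subseteq> cball (pt c w) (L * lam ^ n)" by (rule closure_minimal) simp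
      thus ?thesis using V_clos[of n] by (auto simp: dist_real_def abs_minus_commute)
    qed
    hence "\<bar>x - pt c w\<bar> \<le> 0" by (intro LIMSEQ_le_const[OF lam_power_tendsto]) auto
    thus ?thesis by (simp add: S_eq)
  qed
  thus ?thesis by (metis closure_subset closure_closed closed_closure subsetI subset_antisym)
qed

section \<open>Maximal words below \<open>r\<close>, resets and forced events\<close>

definition low :: "(bool list \<Rightarrow> bool) \<Rightarrow> real \<Rightarrow> nat \<Rightarrow> bool list set" where
  "low c r n = {v. length v = n \<and> pos lam c v \<le> r}"

definition tops :: "(bool list \<Rightarrow> bool) \<Rightarrow> real \<Rightarrow> nat \<Rightarrow> bool list set" where
  "tops c r n = {v \<in> low c r n. \<forall>u \<in> low c r n. pos lam c u \<le> pos lam c v}"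

definition kids :: "(bool list \<Rightarrow> bool) \<Rightarrow> real \<Rightarrow> nat \<Rightarrow> bool list set" where
  "kids c r n = {v @ [d] | v d. v \<in> tops c r n}"

lemma finite_low: "finite (low c r n)"
  by (rule finite_subset[OF _ finite_lists_length_eq[of "UNIV :: bool set" n]]) (auto simp: low_def)

lemma finite_tops: "finite (tops c r n)"
  using finite_low[of c r n] by (auto simp: tops_def)

lemma kids_eq: "kids c r n = (\<lambda>(v, d). v @ [d]) ` (tops c r n \<times> UNIV)"
  by (auto simp: kids_def)

lemma finite_kids: "finite (kids c r n)"
  unfolding kids_eq using finite_tops[of c r n] by auto

lemma tops_nonempty:
  assumes "low c r n \<noteq> {}"
  shows "tops c r n \<noteq> {}"
proof -
  define m where "m = Max (pos lam c ` low c r n)"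
  have "m \<in> pos lam c ` low c r n" unfolding m_def using assms finite_low by (intro Max_in) auto
  then obtain v where v: "v \<in> low c r n" "pos lam c v = m" by auto
  have "pos lam c u \<le> m" if "u \<in> low c r n" for u
    unfolding m_def using that finite_low by (intro Max_ge) auto
  with v show ?thesis by (auto simp: tops_def)
qed

lemma kids_nonempty: "tops c r n \<noteq> {} \<Longrightarrow> kids c r n \<noteq> {}"
  by (auto simp: kids_def)

definition reset :: "(bool list \<Rightarrow> bool) \<Rightarrow> real \<Rightarrow> nat \<Rightarrow> bool" where
  "reset c r n \<longleftrightarrow> tops c r n \<noteq> {} \<and> (\<forall>v\<in>kids c r n. \<not> c v)"

text \<open>Arbitrary if \<open>tops c r n\<close> is empty.\<close>

definition heir :: "(bool list \<Rightarrow> bool) \<Rightarrow> real \<Rightarrow> nat \<Rightarrow> bool list" where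
  "heir c r n = (SOME v. v \<in> kids c r n)"

text \<open>A single equivalence prescribes all fresh digits at once, in the form that
  \<open>expectation_conditional'\<close> handles; the first conjunct makes \<open>heir\<close> a
  genuine child.\<close>

definition forced :: "nat \<Rightarrow> (bool list \<Rightarrow> bool) \<Rightarrow> real \<Rightarrow> nat \<Rightarrow> bool" where
  "forced k c r n \<longleftrightarrow> tops c r n \<noteq> {} \<and>
     (\<forall>y \<in> kids c r n \<union> descendants k (heir c r n). c y \<longleftrightarrow> y \<in> insert (heir c r n) (descendants k (heir c r n)))"

lemma heir_in_kids: "tops c r n \<noteq> {} \<Longrightarrow> heir c r n \<in> kids c r n"
  unfolding heir_def using kids_nonempty by (simp add: some_in_eq)

text \<open>The \<open>j\<close> generations of digit 1 contribute the first \<open>j\<close> terms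
  of the geometric tail with sum \<open>L * lam ^ length v\<close>.\<close>

lemma pos_descendants:
  assumes "\<forall>y\<in>descendants k v. c y" "j \<le> k" "pref w (length v) = v"
  shows "pos lam c (pref w (length v + j)) = pos lam c v + L * (1 - lam ^ j) * lam ^ length v"
  using assms(2)
proof (induction j)
  case 0
  show ?case by (simp add: assms(3))
next
  case (Suc j)
  have eq: "pref w (length v + i) = v @ map w [length v..<length v + i]" for i
    using assms(3) upt_add_eq_append[of 0 "length v" i] by simp
  have "pref w (length v + Suc j) \<in> descendants k v"
    unfolding eq descendants_def using Suc.prems
    by (intro CollectI exI[of _ "map w [length v..<length v + Suc j]"]) auto
  hence c: "c (pref w (length v + j) @ [w (length v + j)])" using assms(1) by (simp add: pref_Suc)
  have "pos lam c (pref w (length v + Suc j)) = pos lam c (pref w (length v + j)) + lam ^ Suc (length v + j)"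
    using c by (simp add: pos_snoc)
  also have "\<dots> = pos lam c v + (L * (1 - lam ^ j) * lam ^ length v + lam ^ Suc (length v + j))"
    using Suc by simp
  also have "L * (1 - lam ^ j) * lam ^ length v + lam ^ Suc (length v + j)
      = (L - (L - lam) * lam ^ j) * lam ^ length v"
    by (simp add: power_add algebra_simps)
  also have "L - (L - lam) * lam ^ j = L * (1 - lam ^ Suc j)"
  proof -
    have "L - lam = lam * L" using L_eq by (simp add: algebra_simps)
    thus ?thesis by (simp only:) (simp add: algebra_simps)
  qed
  finally show ?case .
qed

text \<open>Put \<open>\<mu> = lam ^ Suc n\<close> and let \<open>g\<close> be the maximal digit
  sum. Points through the heir are at least
  \<open>g + \<mu> + L * \<mu> - L * lam ^ k * \<mu>\<close>, the other points up to
  \<open>r\<close> at most \<open>g + \<mu> + L * \<mu> - sep * \<mu>\<close>. The last conclusion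
  supplies points left of \<open>y\<close>, for the proof of disconnectedness.\<close>

lemma forced_gap:
  assumes sep: "\<And>u v. length u = Suc n \<Longrightarrow> length v = Suc n \<Longrightarrow> pos lam c u < pos lam c v \<Longrightarrow>
      pos lam c u + sep * lam ^ Suc n \<le> pos lam c v"
    and k: "L * lam ^ k < sep"
    and gap: "\<And>v. v \<in> low c r n \<Longrightarrow> pos lam c v + L * lam ^ n \<le> r"
    and forced: "forced k c r n"
  obtains y s where "y \<notin> S c" "s \<in> S c" "y < s" "s \<le> r"
    "\<And>t. t \<in> S c \<Longrightarrow> t \<le> r \<Longrightarrow> t < y + sep * lam ^ Suc n"
    "L \<le> r \<Longrightarrow> \<exists>t\<in>S c. t < y"
proof -
  define h where "h = heir c r n"
  define \<mu> where "\<mu> = lam ^ Suc n"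
  have \<mu>: "\<mu> > 0" using lam by (simp add: \<mu>_def)
  have ne: "tops c r n \<noteq> {}" and f: "\<And>y. y \<in> kids c r n \<union> descendants k h \<Longrightarrow> c y \<longleftrightarrow> y \<in> insert h (descendants k h)"
    using forced by (auto simp: forced_def h_def)
  have h: "h \<in> kids c r n" using heir_in_kids[OF ne] by (simp add: h_def)
  then obtain v0 d0 where v0: "h = v0 @ [d0]" "v0 \<in> tops c r n" by (auto simp: kids_def)
  have len: "length h = Suc n" using v0 by (auto simp: tops_def low_def)
  have ch: "c h" using f[of h] h by simp
  have cd: "\<forall>y\<in>descendants k h. c y" using f by auto
  define g where "g = pos lam c v0"
  have g: "g + L * lam ^ n \<le> r" using gap[of v0] v0 by (auto simp: g_def tops_def)
  have ph: "pos lam c h = g + \<mu>" using ch len by (simp add: v0 pos_snoc g_def \<mu>_def)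
  \<comment> \<open>The largest value conceivable below the heir is the one conceivable below its
    parent, which \<open>gap\<close> keeps at most \<open>r\<close>.\<close>
  have top: "g + \<mu> + L * \<mu> = g + L * lam ^ n"
  proof -
    have "\<mu> + L * \<mu> = (lam * (1 + L)) * lam ^ n" by (simp add: \<mu>_def algebra_simps)
    thus ?thesis by (simp only: L_eq)
  qed
  \<comment> \<open>The midpoint between the upper bound for the other points and the lower bound
    for the points through the heir.\<close>
  define y where "y = g + \<mu> + L * \<mu> - (sep + L * lam ^ k) / 2 * \<mu>"
  have k\<mu>: "L * lam ^ k * \<mu> < sep * \<mu>" using k \<mu> by simp
  have k0: "L * lam ^ k > 0" using L_pos lam by simp
  have inside: "y < pt c w" "pt c w \<le> g + \<mu> + L * \<mu>" if "pref w (Suc n) = h" for w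
  proof -
    have "pos lam c (pref w (Suc n + k)) = g + \<mu> + L * (1 - lam ^ k) * \<mu>"
      using pos_descendants[OF cd order_refl, of w] that by (simp only: len ph \<mu>_def)
    hence "g + \<mu> + L * (1 - lam ^ k) * \<mu> \<le> pt c w" using pt_bounds(1)[of c w "Suc n + k"] by simp
    moreover have "y < g + \<mu> + L * (1 - lam ^ k) * \<mu>"
      unfolding y_def using k\<mu> by (simp add: algebra_simps)
    ultimately show "y < pt c w" by simp
    show "pt c w \<le> g + \<mu> + L * \<mu>" using pt_bounds(2)[of c w "Suc n"] unfolding that ph by (simp add: \<mu>_def)
  qed
  have outside: "pt c w < y" if w: "pref w (Suc n) \<noteq> h" and r: "pt c w \<le> r" for w
  proof -
    have "pref w n \<in> low c r n" using pt_bounds(1)[of c w n] r by (simp add: low_def)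
    hence le: "pos lam c (pref w n) \<le> g" using v0 by (auto simp: tops_def g_def)
    have ps: "pos lam c (pref w (Suc n)) = pos lam c (pref w n) + of_bool (c (pref w (Suc n))) * \<mu>"
      by (simp add: pos_snoc \<mu>_def)
    \<comment> \<open>A tie would make this prefix a child of a maximal word with digit 1, and
      \<open>forced\<close> allows only the heir.\<close>
    have "pos lam c (pref w (Suc n)) \<noteq> pos lam c h"
    proof
      assume eq: "pos lam c (pref w (Suc n)) = pos lam c h"
      hence cw: "c (pref w (Suc n))" and "pos lam c (pref w n) = g"
        using ps ph le \<mu> by (auto simp: of_bool_def split: if_splits)
      hence "pref w n \<in> tops c r n" using \<open>pref w n \<in> low c r n\<close> v0 by (auto simp: tops_def g_def)
      hence "pref w (Suc n) \<in> kids c r n" by (auto simp: kids_def)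
      moreover have "pref w (Suc n) \<notin> descendants k h" using len by (auto simp: descendants_def dest!: arg_cong[of _ _ length])
      ultimately show False using f[of "pref w (Suc n)"] cw w by auto
    qed
    moreover have "pos lam c (pref w (Suc n)) \<le> pos lam c h" using ps ph le \<mu> by (auto simp: of_bool_def)
    ultimately have "pos lam c (pref w (Suc n)) + sep * \<mu> \<le> pos lam c h"
      unfolding \<mu>_def using len by (intro sep) auto
    hence "pt c w \<le> g + \<mu> - sep * \<mu> + L * \<mu>" using pt_bounds(2)[of c w "Suc n"] by (simp add: ph \<mu>_def)
    also have "\<dots> < y" unfolding y_def using k\<mu> by (simp add: algebra_simps)
    finally show ?thesis .
  qed
  obtain w0 where w0: "pref w0 (Suc n) = h" using ex_pref[of h] len by auto
  show ?thesis
  proof (rule that[of y "pt c w0"])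
    have "sep + L * lam ^ k > 0" using k k0 by simp
    hence "(sep + L * lam ^ k) / 2 * \<mu> > 0" using \<mu> by simp
    \<comment> \<open>\<open>outside\<close> speaks only of points up to \<open>r\<close>, so
      \<open>y\<close> has to be located there before it can be excluded from
      \<open>S c\<close>.\<close>
    hence "y \<le> r" using top g unfolding y_def by linarith
    thus "y \<notin> S c" using inside(1) outside by (force simp: S_eq)
    show "pt c w0 \<in> S c" by (simp add: S_eq)
    show "y < pt c w0" by (rule inside(1)[OF w0])
    show "pt c w0 \<le> r" using inside(2)[OF w0] top g by simp
    have ysep: "g + \<mu> + L * \<mu> < y + sep * \<mu>" "y < y + sep * \<mu>"
      using k\<mu> k0 \<mu> mult_pos_pos[OF k0 \<mu>] by (simp_all add: y_def algebra_simps)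
    show "t < y + sep * lam ^ Suc n" if "t \<in> S c" "t \<le> r" for t
    proof -
      obtain w where w: "t = pt c w" using \<open>t \<in> S c\<close> by (auto simp: S_eq)
      show ?thesis
      proof (cases "pref w (Suc n) = h")
        case True
        thus ?thesis using inside(2)[OF True] ysep(1) by (simp add: w \<mu>_def)
      next
        case False
        have "t < y" using outside[OF False] that(2) by (simp add: w)
        with ysep(2) show ?thesis by (simp add: \<mu>_def)
      qed
    qed
    show "\<exists>t\<in>S c. t < y" if "L \<le> r"
    proof -
      \<comment> \<open>This word differs from \<open>w0\<close> in its first letter, hence does not
        pass through the heir.\<close>
      define w where "w = (\<lambda>i. \<not> w0 i)"
      have "w 0 \<noteq> w0 0" by (simp add: w_def)
      hence "pref w (Suc n) \<noteq> h" unfolding w0[symmetric] by (auto simp: map_eq_conv simp del: upt_Suc)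
      moreover have "pt c w \<in> S c" by (simp add: S_eq)
      moreover have "pt c w \<le> r" using S_bounds[of c] \<open>pt c w \<in> S c\<close> that by auto
      ultimately show ?thesis using outside by blast
    qed
  qed
qed

text \<open>Without resets from level \<open>n2\<close> on, every later maximal word would descend
  from one of the finitely many maximal words of level \<open>n2\<close> along digits 1 only, but
  all these lines die out.\<close>

lemma infinitely_many_resets:
  assumes ext: "\<And>v. \<exists>m. \<not> survives c m v"
    and low: "\<And>n. n0 \<le> n \<Longrightarrow> low c r n \<noteq> {}"
    and gap: "\<And>n v. n0 \<le> n \<Longrightarrow> v \<in> low c r n \<Longrightarrow> pos lam c v + L * lam ^ n \<le> r"
  shows "infinite {n. reset c r n}"
proof
  assume fin: "finite {n. reset c r n}"
  then obtain n1 where n1: "\<And>n. reset c r n \<Longrightarrow> n < n1"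
    by (metis (mono_tags) finite_nat_set_iff_bounded mem_Collect_eq)
  define n2 where "n2 = max n0 n1"
  have step: "\<exists>v d. u = v @ [d] \<and> v \<in> tops c r n \<and> c u" if n: "n2 \<le> n" and u: "u \<in> tops c r (Suc n)" for n u
  proof -
    have n0: "n0 \<le> n" and "\<not> reset c r n" using n n1[of n] by (auto simp: n2_def)
    moreover have "tops c r n \<noteq> {}" using low[OF n0] by (rule tops_nonempty)
    ultimately obtain v1 d1 where v1: "v1 \<in> tops c r n" "c (v1 @ [d1])" by (auto simp: reset_def kids_def)
    have lv1: "length v1 = n" "v1 \<in> low c r n" using v1 by (auto simp: tops_def low_def)
    have p1: "pos lam c (v1 @ [d1]) = pos lam c v1 + lam ^ Suc n" using v1 lv1 by (simp add: pos_snoc)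
    \<comment> \<open>The room \<open>L * lam ^ n\<close> left below \<open>r\<close> suffices for
      one more digit 1.\<close>
    have "lam ^ Suc n \<le> L * lam ^ n" using lam_le_L lam by (simp add: mult_right_mono)
    hence "pos lam c (v1 @ [d1]) \<le> r" using gap[OF n0 lv1(2)] p1 by simp
    hence low1: "v1 @ [d1] \<in> low c r (Suc n)" using lv1 by (simp add: low_def)
    have u': "length u = Suc n" "pos lam c u \<le> r" "pos lam c (v1 @ [d1]) \<le> pos lam c u"
      using u low1 by (auto simp: tops_def low_def)
    obtain v d where vd: "u = v @ [d]" using u'(1) by (metis length_Suc_conv_rev)
    have lv: "length v = n" using u' vd by simp
    have pu: "pos lam c u = pos lam c v + of_bool (c u) * lam ^ Suc n" using lv by (simp add: vd pos_snoc)
    have "0 < lam ^ Suc n" using lam by simp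
    hence "pos lam c v \<le> r" using pu u'(2) by (auto simp: of_bool_def split: if_splits)
    hence "v \<in> low c r n" using lv by (simp add: low_def)
    hence "pos lam c v \<le> pos lam c v1" using v1 by (auto simp: tops_def)
    \<comment> \<open>To reach the sum of \<open>v1 @ [d1]\<close>, the word \<open>u\<close> needs
      both a maximal parent and the last digit 1.\<close>
    with pu u'(3) p1 \<open>0 < lam ^ Suc n\<close> have "c u" "pos lam c v = pos lam c v1"
      by (auto simp: of_bool_def split: if_splits)
    moreover from this have "v \<in> tops c r n" using v1 \<open>v \<in> low c r n\<close> by (auto simp: tops_def)
    ultimately show ?thesis using vd by blast
  qed
  have reach: "\<exists>v y. u = v @ y \<and> v \<in> tops c r n2 \<and> length y = m \<and> (\<forall>j<m. c (v @ take (Suc j) y))"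
    if "u \<in> tops c r (n2 + m)" for u m
    using that
  proof (induction m arbitrary: u)
    case 0
    thus ?case by auto
  next
    case (Suc m)
    obtain u' d where u': "u = u' @ [d]" "u' \<in> tops c r (n2 + m)" "c u"
      using step[of "n2 + m" u] Suc.prems by auto
    obtain v y where vy: "u' = v @ y" "v \<in> tops c r n2" "length y = m" "\<forall>j<m. c (v @ take (Suc j) y)"
      using Suc.IH[OF u'(2)] by blast
    have "c (v @ take (Suc j) (y @ [d]))" if "j < Suc m" for j
      using that vy u' by (cases "j = m") auto
    thus ?case using u' vy by (intro exI[of _ v] exI[of _ "y @ [d]"]) auto
  qed
  obtain M where M: "\<And>v. \<not> survives c (M v) v" using ext by metis
  define m where "m = Max (M ` tops c r n2)"
  have ns: "\<not> survives c m v" if "v \<in> tops c r n2" for v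
  proof -
    have "M v \<le> m" unfolding m_def using that finite_tops by (intro Max_ge) auto
    thus ?thesis using M survives_mono by blast
  qed
  have "tops c r (n2 + m) \<noteq> {}" by (intro tops_nonempty low) (simp add: n2_def)
  then obtain u where "u \<in> tops c r (n2 + m)" by auto
  from reach[OF this] ns show False by (auto simp: survives_def)
qed

text \<open>As \<open>S c\<close> is closed, \<open>r\<close> has a positive distance from it, while
  a cylinder of level \<open>n\<close> straddling \<open>r\<close> would contain a point closer than
  \<open>L * lam ^ n\<close>.\<close>

lemma eventually_low_gap:
  assumes "r \<notin> S c"
  shows "\<exists>n0. \<forall>n\<ge>n0. \<forall>v\<in>low c r n. pos lam c v + L * lam ^ n \<le> r"
proof -
  have "open (- S c)" using closed_S by (simp add: open_Compl)
  then obtain e where e: "e > 0" "\<And>x. \<bar>x - r\<bar> < e \<Longrightarrow> x \<notin> S c"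
    using assms unfolding open_dist dist_real_def by (metis ComplD ComplI)
  obtain n0 where n0: "\<And>n. n \<ge> n0 \<Longrightarrow> L * lam ^ n < e" using ex_small_power[OF e(1)] by blast
  have "pos lam c v + L * lam ^ n \<le> r" if n: "n0 \<le> n" and v: "v \<in> low c r n" for n v
  proof (rule ccontr)
    assume neg: "\<not> pos lam c v + L * lam ^ n \<le> r"
    obtain w where w: "pref w (length v) = v" using ex_pref by blast
    have lv: "length v = n" "pos lam c v \<le> r" using v by (auto simp: low_def)
    have "pos lam c v \<le> pt c w" "pt c w \<le> pos lam c v + L * lam ^ n"
      using pt_bounds[of c w n] w lv by auto
    hence "\<bar>pt c w - r\<bar> < e" using n0[OF n] neg lv by linarith
    thus False using e(2)[of "pt c w"] by (simp add: S_eq)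
  qed
  thus ?thesis by blast
qed

lemma low_nonempty:
  assumes "s \<in> S c" "s \<le> r"
  shows "low c r n \<noteq> {}"
proof -
  obtain w where "s = pt c w" using assms(1) by (auto simp: S_eq)
  hence "pref w n \<in> low c r n" using pt_bounds(1)[of c w n] assms(2) by (simp add: low_def)
  thus ?thesis by blast
qed

end

section \<open>Holes of the attractor for a single good assignment of digits\<close>

text \<open>Collects what holds almost surely, so that the argument becomes deterministic.
  \<open>forcing\<close> speaks of rational \<open>r\<close>, which leaves countably many null sets
  to avoid.\<close>

locale forcing_tree = contraction lam for lam +
  fixes c :: "bool list \<Rightarrow> bool" and sep :: real and k :: nat
  assumes sep: "\<And>n u v. length u = n \<Longrightarrow> length v = n \<Longrightarrow> pos lam c u < pos lam c v \<Longrightarrow>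
      pos lam c u + sep * lam ^ n \<le> pos lam c v"
    and k: "L * lam ^ k < sep"
    and extinct: "\<And>v. \<exists>m. \<not> survives c m v"
    and forcing: "\<And>r n0. r \<in> \<rat> \<Longrightarrow> infinite {n. reset c r n} \<Longrightarrow> \<exists>n\<ge>n0. forced k c r n"
begin

text \<open>A forced event at a level so late that \<open>sep * lam ^ Suc n < \<epsilon>\<close>
  places the hole close to the last points of \<open>S c\<close> before \<open>r\<close>.\<close>

lemma left_hole:
  assumes "r \<in> \<rat>" "r \<notin> S c" "s0 \<in> S c" "s0 \<le> r" "\<epsilon> > 0"
  obtains y s where "y \<notin> S c" "s \<in> S c" "y < s" "s \<le> r" "\<And>t. t \<in> S c \<Longrightarrow> t \<le> r \<Longrightarrow> t < y + \<epsilon>"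
    "L \<le> r \<Longrightarrow> \<exists>t\<in>S c. t < y"
proof -
  obtain n0 where n0: "\<And>n v. n0 \<le> n \<Longrightarrow> v \<in> low c r n \<Longrightarrow> pos lam c v + L * lam ^ n \<le> r"
    using eventually_low_gap[OF assms(2)] by blast
  obtain n1 where n1: "\<And>n. n1 \<le> n \<Longrightarrow> sep * lam ^ n < \<epsilon>" using ex_small_power[OF assms(5)] by blast
  have "infinite {n. reset c r n}"
    using infinitely_many_resets[OF extinct low_nonempty[OF assms(3,4)] n0] .
  then obtain n where n: "n \<ge> max n0 n1" "forced k c r n" using forcing[OF assms(1)] by blast
  obtain y s where ys: "y \<notin> S c" "s \<in> S c" "y < s" "s \<le> r"
    "\<And>t. t \<in> S c \<Longrightarrow> t \<le> r \<Longrightarrow> t < y + sep * lam ^ Suc n" "L \<le> r \<Longrightarrow> \<exists>t\<in>S c. t < y"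
    by (rule forced_gap[OF sep k n0 n(2)]) (use n in auto)
  moreover have "t < y + \<epsilon>" if "t \<in> S c" "t \<le> r" for t
    using ys(5)[OF that] n1[of "Suc n"] n by simp
  ultimately show ?thesis using that by blast
qed

text \<open>For a rational \<open>q\<close> inside the gap, the points of \<open>S c\<close> up to
  \<open>q\<close> are those up to \<open>\<alpha>\<close>, so \<open>left_hole\<close> gives a hole
  within \<open>\<epsilon>\<close> to the left of \<open>\<alpha>\<close>.\<close>

lemma left_endpoint_not_isolated:
  assumes "\<alpha> \<in> S c" "\<alpha> < r" "{\<alpha><..<r} \<inter> S c = {}" "\<epsilon> > 0"
  shows "\<not> {\<alpha> - \<epsilon><..<\<alpha>} \<subseteq> S c"
proof -
  obtain q where q: "q \<in> \<rat>" "\<alpha> < q" "q < r" using Rats_dense_in_real[OF assms(2)] by blast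
  have "q \<notin> S c" using q assms(3) by auto
  then obtain y s where ys: "y \<notin> S c" "s \<in> S c" "y < s" "s \<le> q" "\<And>t. t \<in> S c \<Longrightarrow> t \<le> q \<Longrightarrow> t < y + \<epsilon>"
    using left_hole[of q \<alpha> \<epsilon>] q assms by (metis less_imp_le)
  have "s \<le> \<alpha>" using assms(3) ys q by (force simp: not_le)
  moreover have "\<alpha> < y + \<epsilon>" using ys(5)[of \<alpha>] assms(1) q by simp
  ultimately have "y \<in> {\<alpha> - \<epsilon><..<\<alpha>}" using ys(3) by auto
  thus ?thesis using ys(1) by blast
qed

text \<open>A rational \<open>q\<close> beyond \<open>L\<close> has all of \<open>S c\<close> on its
  left, and then \<open>left_hole\<close> gives a hole with points of \<open>S c\<close> on both
  sides.\<close>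

lemma S_not_connected: "\<not> connected (S c)"
proof
  assume conn: "connected (S c)"
  obtain q where q: "q \<in> \<rat>" "L < q" using Rats_dense_in_real[of L "L + 1"] by auto
  have "pt c (\<lambda>_. True) \<in> S c" by (simp add: S_eq)
  moreover have "q \<notin> S c" using S_bounds[of c] q by auto
  ultimately obtain y s where ys: "y \<notin> S c" "s \<in> S c" "y < s" "\<exists>t\<in>S c. t < y"
    using left_hole[of q "pt c (\<lambda>_. True)" 1] q S_bounds[of c] by (smt (verit) atLeastAtMost_iff subsetD)
  then obtain t where "t \<in> S c" "t < y" by blast
  hence "y \<in> S c" using connectedD_interval[OF conn, of t s y] ys by simp
  thus False using ys(1) by simp
qed

end

section \<open>Finite endpoints of the components of the complement of a closed set\<close>

text \<open>Components of the open set \<open>- X\<close> are open, so \<open>Inf C\<close> is not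
  in \<open>C\<close>. Were it outside \<open>X\<close>, a ball around it would meet
  \<open>C\<close> and be absorbed by maximality.\<close>

lemma component_Inf:
  fixes X :: "real set"
  assumes "closed X" "C \<in> components (- X)" "bdd_below C"
  obtains r where "Inf C \<in> X" "Inf C < r" "{Inf C<..<r} \<inter> X = {}"
proof -
  have C: "C \<noteq> {}" "connected C" "C \<subseteq> - X" "open C"
    using in_components_nonempty[OF assms(2)] in_components_connected[OF assms(2)]
      in_components_subset[OF assms(2)] open_components[OF _ assms(2)] assms(1)
    by (simp_all add: open_Compl)
  obtain r where r: "r \<in> C" using C by blast
  have low: "Inf C \<le> x" if "x \<in> C" for x using that assms(3) by (rule cInf_lower)
  have notin: "Inf C \<notin> C"
  proof
    assume "Inf C \<in> C"
    then obtain e where e: "e > 0" "ball (Inf C) e \<subseteq> C" using C(4) by (auto simp: open_contains_ball)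
    hence "Inf C - e / 2 \<in> C" by (auto simp: dist_real_def)
    with low[OF this] e show False by simp
  qed
  have between: "x \<in> C" if x: "Inf C < x" "x \<le> r" for x
  proof -
    obtain z where z: "z \<in> C" "z < x" using cInf_less_iff[OF C(1) assms(3), of x] x by blast
    thus ?thesis using connectedD_interval[OF C(2) z(1) r] x by simp
  qed
  have "Inf C \<in> X"
  proof (rule ccontr)
    assume "Inf C \<notin> X"
    then obtain e where e: "e > 0" "ball (Inf C) e \<subseteq> - X"
      using assms(1) by (metis ComplI open_Compl open_contains_ball)
    obtain z where z: "z \<in> C" "z < Inf C + e" using cInf_less_iff[OF C(1) assms(3), of "Inf C + e"] e by auto
    hence "z \<in> C \<inter> ball (Inf C) e" using low[OF z(1)] e by (auto simp: dist_real_def)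
    hence "C \<inter> ball (Inf C) e \<noteq> {}" by blast
    hence "ball (Inf C) e \<subseteq> C" by (rule components_maximal[OF assms(2) connected_ball e(2)])
    thus False using notin centre_in_ball[of _ e] e(1) by blast
  qed
  moreover have "Inf C < r" using low[OF r] r notin by (metis le_less)
  moreover have "{Inf C<..<r} \<inter> X = {}" using between C(3) by force
  ultimately show ?thesis using that by blast
qed

lemma component_Sup:
  fixes X :: "real set"
  assumes "closed X" "C \<in> components (- X)" "bdd_above C"
  obtains r where "Sup C \<in> X" "r < Sup C" "{r<..<Sup C} \<inter> X = {}"
proof -
  have C: "C \<noteq> {}" "connected C" "C \<subseteq> - X" "open C"
    using in_components_nonempty[OF assms(2)] in_components_connected[OF assms(2)]
      in_components_subset[OF assms(2)] open_components[OF _ assms(2)] assms(1)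
    by (simp_all add: open_Compl)
  obtain r where r: "r \<in> C" using C by blast
  have high: "x \<le> Sup C" if "x \<in> C" for x using that assms(3) by (rule cSup_upper)
  have notin: "Sup C \<notin> C"
  proof
    assume "Sup C \<in> C"
    then obtain e where e: "e > 0" "ball (Sup C) e \<subseteq> C" using C(4) by (auto simp: open_contains_ball)
    hence "Sup C + e / 2 \<in> C" by (auto simp: dist_real_def)
    with high[OF this] e show False by simp
  qed
  have between: "x \<in> C" if x: "x < Sup C" "r \<le> x" for x
  proof -
    obtain z where z: "z \<in> C" "x < z" using less_cSup_iff[OF C(1) assms(3), of x] x by blast
    thus ?thesis using connectedD_interval[OF C(2) r z(1)] x by simp
  qed
  have "Sup C \<in> X"
  proof (rule ccontr)
    assume "Sup C \<notin> X"
    then obtain e where e: "e > 0" "ball (Sup C) e \<subseteq> - X"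
      using assms(1) by (metis ComplI open_Compl open_contains_ball)
    obtain z where z: "z \<in> C" "Sup C - e < z" using less_cSup_iff[OF C(1) assms(3), of "Sup C - e"] e by auto
    hence "z \<in> C \<inter> ball (Sup C) e" using high[OF z(1)] e by (auto simp: dist_real_def)
    hence "C \<inter> ball (Sup C) e \<noteq> {}" by blast
    hence "ball (Sup C) e \<subseteq> C" by (rule components_maximal[OF assms(2) connected_ball e(2)])
    thus False using notin centre_in_ball[of _ e] e(1) by blast
  qed
  moreover have "r < Sup C" using high[OF r] r notin by (metis le_less)
  moreover have "{r<..<Sup C} \<inter> X = {}" using between C(3) by force
  ultimately show ?thesis using that by blast
qed

section \<open>Random digits on the binary tree\<close>

text \<open>Flipping turns the pattern \<open>C\<close> over \<open>A\<close> into the pattern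
  \<open>A - C\<close>.\<close>

lemma fair_bits_complement:
  assumes "fair_bits M I b"
  shows "fair_bits M I (\<lambda>v x. \<not> b v x)"
proof -
  interpret fair_bits M I b by fact
  have eq: "{x \<in> space M. \<forall>v\<in>A. (\<not> b v x) = (v \<in> C)} = {x \<in> space M. \<forall>v\<in>A. b v x = (v \<in> A - C)}" for A C
    by auto
  show ?thesis
    by unfold_locales (simp_all only: eq cyl_events prob_cyl Diff_subset)
qed

lemma (in prob_space) fair_bits_of_indep_vars:
  fixes a :: "'i \<Rightarrow> 'a \<Rightarrow> real"
  assumes ind: "indep_vars (\<lambda>_. borel) a I"
    and half: "\<And>v. v \<in> I \<Longrightarrow> prob {x \<in> space M. a v x = 1} = 1/2"
  shows "fair_bits M I (\<lambda>v x. a v x = 1)"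
proof -
  have "{x \<in> space M. \<forall>v\<in>A. (a v x = 1) = (v \<in> C)} \<in> events \<and>
      prob {x \<in> space M. \<forall>v\<in>A. (a v x = 1) = (v \<in> C)} = (1/2) ^ card A"
    if A: "finite A" "A \<subseteq> I" for A C
  proof -
    define B where "B v = (if v \<in> C then {1} else - {1::real})" for v
    have rv: "random_variable borel (a v)" if "v \<in> I" for v
      using ind that by (auto simp: indep_vars_def)
    have B: "B v \<in> sets borel" for v by (auto simp: B_def)
    have pB: "prob (a v -` B v \<inter> space M) = 1/2" if "v \<in> A" for v
    proof -
      have v: "v \<in> I" using that A by auto
      have ev: "{x \<in> space M. a v x = 1} \<in> events" using rv[OF v] by measurable
      have "a v -` B v \<inter> space M = (if v \<in> C then {x \<in> space M. a v x = 1} else space M - {x \<in> space M. a v x = 1})"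
        by (auto simp: B_def)
      thus ?thesis using half[OF v] prob_compl[OF ev] by simp
    qed
    show ?thesis
    proof (cases "A = {}")
      case True
      thus ?thesis by (simp add: prob_space)
    next
      case False
      have eq: "{x \<in> space M. \<forall>v\<in>A. (a v x = 1) = (v \<in> C)} = (\<Inter>v\<in>A. a v -` B v \<inter> space M)"
        using False by (auto simp: B_def split: if_splits)
      have "(\<Inter>v\<in>A. a v -` B v \<inter> space M) \<in> events"
        using A False rv B by (intro sets.finite_INT measurable_sets) auto
      moreover have "prob (\<Inter>v\<in>A. a v -` B v \<inter> space M) = (\<Prod>v\<in>A. prob (a v -` B v \<inter> space M))"
        using A False B by (intro indep_varsD[OF ind]) auto
      ultimately show ?thesis unfolding eq by (simp add: pB)
    qed
  qed
  thus ?thesis by unfold_locales blast+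
qed

section \<open>Extinction of the critical branching process of digits 1\<close>

definition nodes :: "nat \<Rightarrow> bool list set" where
  "nodes n = {v. v \<noteq> [] \<and> length v \<le> n}"

lemma finite_nodes [simp]: "finite (nodes n)"
  by (rule finite_subset[OF _ finite_lists_length_le[of "UNIV :: bool set" n]]) (auto simp: nodes_def)

lemma nodes_mono: "m \<le> n \<Longrightarrow> nodes m \<subseteq> nodes n"
  by (auto simp: nodes_def)

lemma descendants_eq: "descendants k v = (@) v ` nodes k"
  by (auto simp: descendants_def nodes_def)

lemma finite_descendants [simp]: "finite (descendants k (v :: bool list))"
  by (simp add: descendants_eq)

lemma descendants_nonempty: "descendants k v \<subseteq> {v. v \<noteq> []}"
  by (auto simp: descendants_def)

lemma not_in_descendants: "length u \<le> length v \<Longrightarrow> u \<notin> descendants k v"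
  by (auto simp: descendants_def)

lemma card_descendants: "card (descendants k (v :: bool list)) = card (nodes k)"
  unfolding descendants_eq by (rule card_image) (auto intro: inj_onI)

lemma survives_Suc: "survives c (Suc m) v \<longleftrightarrow> (\<exists>d. c (v @ [d]) \<and> survives c m (v @ [d]))"
proof
  assume "survives c (Suc m) v"
  then obtain y where y: "length y = Suc m" "\<forall>j<Suc m. c (v @ take (Suc j) y)" by (auto simp: survives_def)
  then obtain d z where z: "y = d # z" by (cases y) auto
  have "c (v @ [d])" using y(2) z by force
  moreover have "c ((v @ [d]) @ take (Suc j) z)" if "j < m" for j using y(2) that by (force simp: z)
  ultimately show "\<exists>d. c (v @ [d]) \<and> survives c m (v @ [d])"
    using y(1) z unfolding survives_def by (intro exI[of _ d] conjI exI[of _ z]) auto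
next
  assume "\<exists>d. c (v @ [d]) \<and> survives c m (v @ [d])"
  then obtain d z where d: "c (v @ [d])" "length z = m" "\<forall>j<m. c ((v @ [d]) @ take (Suc j) z)" by (auto simp: survives_def)
  have "c (v @ take (Suc j) (d # z))" if "j < Suc m" for j using d that by (cases j) auto
  thus "survives c (Suc m) v" using d(2) unfolding survives_def by (intro exI[of _ "d # z"]) auto
qed

lemma survives_depends_on: "depends_on (descendants m v) (\<lambda>c. survives c m v)"
proof (rule depends_onI)
  fix c c' :: "'a list \<Rightarrow> bool"
  assume eq: "\<And>u. u \<in> descendants m v \<Longrightarrow> c u = c' u"
  have "c (v @ take (Suc j) y) = c' (v @ take (Suc j) y)" if "length y = m" "j < m" for y j
    using that by (intro eq) (auto simp: descendants_def)
  thus "survives c m v = survives c' m v" unfolding survives_def by blast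
qed

text \<open>Survival of the Galton--Watson process with binomial offspring (2 trials, probability
  1/2): it fails iff each child carries 0 or founds a line that dies out too early.\<close>

primrec survival_prob :: "nat \<Rightarrow> real" where
  "survival_prob 0 = 1"
| "survival_prob (Suc m) = 1 - (1 - survival_prob m / 2)\<^sup>2"

text \<open>One step lowers the value by the square of \<open>survival_prob m / 2\<close>; by
  criticality there is no linear term, and 0 is the only possible limit.\<close>

lemma survival_prob_tendsto: "survival_prob \<longlonglongrightarrow> 0"
proof -
  have range: "0 \<le> survival_prob m \<and> survival_prob m \<le> 1" for m
  proof (induction m)
    case (Suc m)
    have "(1 - survival_prob m / 2)\<^sup>2 \<le> 1" using Suc by (intro power_le_one) auto
    thus ?case by simp
  qed simp
  have "decseq survival_prob"
  proof (rule decseq_SucI)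
    fix m
    have "survival_prob m - survival_prob (Suc m) = (survival_prob m / 2)\<^sup>2"
      by (simp add: power2_eq_square algebra_simps)
    thus "survival_prob (Suc m) \<le> survival_prob m" by (smt (verit) zero_le_power2)
  qed
  then obtain l where l: "survival_prob \<longlonglongrightarrow> l"
    using decseq_convergent[of survival_prob 0] range by metis
  have "(\<lambda>m. survival_prob (Suc m)) \<longlonglongrightarrow> 1 - (1 - l / 2)\<^sup>2"
    unfolding survival_prob.simps by (intro tendsto_intros l) auto
  hence "l = 1 - (1 - l / 2)\<^sup>2" using l LIMSEQ_Suc LIMSEQ_unique by blast
  hence "l = 0" by (simp add: power2_eq_square algebra_simps)
  thus ?thesis using l by simp
qed

locale tree_bits = fair_bits M "{v. v \<noteq> []}" b for M :: "'w measure" and b :: "bool list \<Rightarrow> 'w \<Rightarrow> bool"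
begin

text \<open>The two children together with their subtrees use disjoint sets of digits, so their
  failures are independent.\<close>

lemma prob_survives: "prob {x \<in> space M. survives (bits x) m v} = survival_prob m"
proof (induction m arbitrary: v)
  case 0
  show ?case by (simp add: survives_def prob_space)
next
  case (Suc m)
  define A where "A d = insert (v @ [d]) (descendants m (v @ [d]))" for d
  define P where "P d c \<longleftrightarrow> c (v @ [d]) \<and> survives c m (v @ [d])" for d c
  have A: "finite (A d)" "A d \<subseteq> {v. v \<noteq> []}" for d
    using descendants_nonempty[of m "v @ [d]"] by (auto simp: A_def)
  have P: "depends_on (A d) (P d)" for d
    unfolding P_def[abs_def]
    by (rule depends_on_comp2, rule depends_onI, simp add: A_def,
        rule depends_on_mono[OF survives_depends_on], auto simp: A_def)
  have nP: "depends_on (A d) (\<lambda>c. \<not> P d c)" for d by (rule depends_on_comp[OF P])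
  have "prob {x \<in> space M. P d (bits x)} = survival_prob m / 2" for d
  proof -
    have "prob {x \<in> space M. bits x (v @ [d]) \<and> survives (bits x) m (v @ [d])}
        = prob {x \<in> space M. bits x (v @ [d])} * prob {x \<in> space M. survives (bits x) m (v @ [d])}"
    proof (rule prob_bits_conj[where A = "{v @ [d]}" and B = "descendants m (v @ [d])"])
      show "depends_on {v @ [d]} (\<lambda>c. c (v @ [d]))" by (rule depends_onI) simp
      show "depends_on (descendants m (v @ [d])) (\<lambda>c. survives c m (v @ [d]))" by (rule survives_depends_on)
    qed (simp_all add: descendants_nonempty not_in_descendants)
    thus ?thesis by (simp add: P_def Suc prob_bit)
  qed
  hence n: "prob {x \<in> space M. \<not> P d (bits x)} = 1 - survival_prob m / 2" for d
    using prob_bits_not[OF A P, of d] by simp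
  have "A False \<inter> A True = {}" by (auto simp: A_def descendants_def)
  hence nn: "prob {x \<in> space M. \<not> P False (bits x) \<and> \<not> P True (bits x)} = (1 - survival_prob m / 2)\<^sup>2"
    using prob_bits_conj[OF A nP A nP] n by (simp add: power2_eq_square)
  have s: "survives c (Suc m) v \<longleftrightarrow> \<not> (\<not> P False c \<and> \<not> P True c)" for c
    unfolding survives_Suc P_def ex_bool_eq by blast
  have dep: "depends_on (A False \<union> A True) (\<lambda>c. \<not> P False c \<and> \<not> P True c)"
    by (rule depends_on_comp2[OF depends_on_mono[OF nP] depends_on_mono[OF nP]]) auto
  show ?case unfolding s using prob_bits_not[OF _ _ dep] A nn by simp
qed

lemma AE_extinct: "AE x in M. \<forall>v. \<exists>m. \<not> survives (bits x) m v"
proof (subst AE_all_countable, rule allI)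
  fix v :: "bool list"
  define F where "F m = {x \<in> space M. survives (bits x) m v}" for m
  have F: "F m \<in> events" for m
    unfolding F_def by (rule events_bits[OF _ _ survives_depends_on]) (simp_all add: descendants_nonempty)
  have N: "(\<Inter>m. F m) \<in> events" by (intro sets.countable_INT image_subsetI F UNIV_not_empty)
  have "prob (\<Inter>m. F m) \<le> survival_prob m" for m
    using finite_measure_mono[OF INT_lower[of m UNIV F] F] prob_survives[of m v] by (simp add: F_def)
  hence "prob (\<Inter>m. F m) \<le> 0" by (intro LIMSEQ_le_const[OF survival_prob_tendsto]) auto
  hence "emeasure M (\<Inter>m. F m) = 0" by (simp add: emeasure_eq_measure measure_le_0_iff)
  thus "AE x in M. \<exists>m. \<not> survives (bits x) m v"
    using N by (intro AE_I[of _ _ "\<Inter>m. F m"]) (auto simp: F_def)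
qed

end

section \<open>Finite dependence of the tree events and their conditional probabilities\<close>

lemma pos_depends_on:
  assumes "length v \<le> n"
  shows "depends_on (nodes n) (\<lambda>c. pos lam c v)"
proof (rule depends_onI)
  fix c c' :: "bool list \<Rightarrow> bool"
  assume eq: "\<And>v. v \<in> nodes n \<Longrightarrow> c v = c' v"
  have "c (take (Suc j) v) = c' (take (Suc j) v)" if "j < length v" for j
    using that assms by (intro eq) (auto simp: nodes_def)
  thus "pos lam c v = pos lam c' v" unfolding pos_def by (intro sum.cong) auto
qed

context contraction
begin

lemma tops_depends_on: "depends_on (nodes n) (\<lambda>c. tops c r n)"
proof (rule depends_onI)
  fix c c' :: "bool list \<Rightarrow> bool"
  assume eq: "\<And>v. v \<in> nodes n \<Longrightarrow> c v = c' v"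
  have p: "pos lam c v = pos lam c' v" if "length v = n" for v
    using depends_onD[OF pos_depends_on[of v n] eq] that by simp
  have "low c r n = low c' r n" unfolding low_def using p by auto
  thus "tops c r n = tops c' r n" unfolding tops_def using p by (auto simp: low_def)
qed

lemma kids_depends_on: "depends_on (nodes n) (\<lambda>c. kids c r n)"
  unfolding kids_def by (rule depends_on_comp[OF tops_depends_on])

lemma heir_depends_on: "depends_on (nodes n) (\<lambda>c. heir c r n)"
  unfolding heir_def by (rule depends_on_comp[OF kids_depends_on])

lemma kids_length: "v \<in> kids c r n \<Longrightarrow> length v = Suc n"
  by (auto simp: kids_def tops_def low_def)

lemma reset_depends_on: "depends_on (nodes (Suc n)) (\<lambda>c. reset c r n)"
proof (rule depends_onI)
  fix c c' :: "bool list \<Rightarrow> bool"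
  assume eq: "\<And>v. v \<in> nodes (Suc n) \<Longrightarrow> c v = c' v"
  have eq': "c v = c' v" if "v \<in> nodes n" for v using eq that nodes_mono[of n "Suc n"] by auto
  have "tops c r n = tops c' r n" "kids c r n = kids c' r n"
    using depends_onD[OF tops_depends_on eq'] depends_onD[OF kids_depends_on eq'] by auto
  moreover have "c v = c' v" if "v \<in> kids c' r n" for v
    using kids_length[OF that] by (intro eq) (auto simp: nodes_def)
  ultimately show "reset c r n = reset c' r n" by (simp add: reset_def)
qed

lemma forced_depends_on: "depends_on (nodes (Suc n + k)) (\<lambda>c. forced k c r n)"
proof (rule depends_onI)
  fix c c' :: "bool list \<Rightarrow> bool"
  assume eq: "\<And>v. v \<in> nodes (Suc n + k) \<Longrightarrow> c v = c' v"
  have eq': "c v = c' v" if "v \<in> nodes n" for v using eq that nodes_mono[of n "Suc n + k"] by auto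
  have same: "tops c r n = tops c' r n" "kids c r n = kids c' r n" "heir c r n = heir c' r n"
    using depends_onD[OF tops_depends_on eq'] depends_onD[OF kids_depends_on eq'] depends_onD[OF heir_depends_on eq'] by auto
  show "forced k c r n = forced k c' r n"
  \<comment> \<open>Without maximal words \<open>heir\<close> could be any word, of any length, but
    then \<open>forced\<close> is simply false.\<close>
  proof (cases "tops c' r n = {}")
    case True
    thus ?thesis by (simp add: forced_def same)
  next
    case False
    have "c v = c' v" if "v \<in> kids c' r n \<union> descendants k (heir c' r n)" for v
      using that kids_length[of v c' r n] kids_length[OF heir_in_kids[OF False]]
      by (intro eq) (auto simp: nodes_def descendants_def)
    thus ?thesis unfolding forced_def same by auto
  qed
qed

lemma reset_forced_disjoint: "reset c r n \<Longrightarrow> forced k c r n \<Longrightarrow> False"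
  using heir_in_kids[of c r n] by (auto simp: reset_def forced_def)

end

locale tree_bits_contraction = tree_bits M b + contraction lam
  for M :: "'w measure" and b and lam
begin

text \<open>Given the first \<open>n\<close> levels, a reset prescribes the fresh digits on
  \<open>kids\<close>, a forced event these and \<open>card (nodes k)\<close> more. The quotient of
  the conditional probabilities is the constant \<open>\<delta>\<close> of the martingale
  argument.\<close>

lemma expectation_forced:
  fixes g :: "(bool list \<Rightarrow> bool) \<Rightarrow> real"
  assumes g: "depends_on (nodes n) g"
  shows "expectation (\<lambda>x. g (bits x) * of_bool (forced k (bits x) r n))
    = (1/2) ^ card (nodes k) * expectation (\<lambda>x. g (bits x) * of_bool (reset (bits x) r n))"
proof -
  define g1 where "g1 c = g c * of_bool (tops c r n \<noteq> {})" for c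
  \<comment> \<open>Empty without maximal words, where an arbitrary heir could point at digits
    already read; \<open>g1\<close> vanishes in that case.\<close>
  define K where "K c = (if tops c r n = {} then {} else kids c r n \<union> descendants k (heir c r n))" for c
  define T where "T c = insert (heir c r n) (descendants k (heir c r n))" for c
  have nodes: "nodes n \<subseteq> {v. v \<noteq> []}" by (auto simp: nodes_def)
  have g1: "depends_on (nodes n) g1"
    unfolding g1_def[abs_def] by (rule depends_on_comp2[OF g depends_on_comp[OF tops_depends_on]])
  have K: "depends_on (nodes n) K"
  proof (rule depends_onI)
    fix c c' :: "bool list \<Rightarrow> bool" assume eq: "\<And>v. v \<in> nodes n \<Longrightarrow> c v = c' v"
    show "K c = K c'"
      using depends_onD[OF tops_depends_on eq] depends_onD[OF kids_depends_on eq] depends_onD[OF heir_depends_on eq]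
      by (simp add: K_def)
  qed
  have T: "depends_on (nodes n) T" unfolding T_def[abs_def] by (rule depends_on_comp[OF heir_depends_on])
  have finK: "finite (K c)" for c using finite_kids[of c r n] by (simp add: K_def)
  have lenK: "Suc n \<le> length v" if v: "v \<in> K c" for v c
  proof -
    have ne: "tops c r n \<noteq> {}" using v by (auto simp: K_def)
    consider "v \<in> kids c r n" | "v \<in> descendants k (heir c r n)" using v ne by (auto simp: K_def)
    thus ?thesis
    proof cases
      case 1
      thus ?thesis by (simp add: kids_length)
    next
      case 2
      thus ?thesis using kids_length[OF heir_in_kids[OF ne]] by (auto simp: descendants_def)
    qed
  qed
  have subK: "K c \<subseteq> {v. v \<noteq> []} - nodes n" for c
    using lenK[of _ c] by (fastforce simp: nodes_def)
  have subkids: "kids c r n \<subseteq> {v. v \<noteq> []} - nodes n" for c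
    using kids_length[of _ c r n] by (fastforce simp: nodes_def)
  have cardK: "g1 c * (1/2) ^ card (K c) = (1/2) ^ card (nodes k) * (g1 c * (1/2) ^ card (kids c r n))" for c
  proof (cases "tops c r n = {}")
    case True
    thus ?thesis by (simp add: g1_def)
  next
    case False
    have "kids c r n \<inter> descendants k (heir c r n) = {}"
      using not_in_descendants[of _ "heir c r n" k] kids_length[of _ c r n] kids_length[OF heir_in_kids[OF False]]
      by (metis disjoint_iff order_refl)
    hence "card (K c) = card (kids c r n) + card (nodes k)"
      using False finite_kids[of c r n] by (simp add: K_def card_Un_disjoint card_descendants)
    thus ?thesis by (simp add: power_add)
  qed
  have "expectation (\<lambda>x. g (bits x) * of_bool (forced k (bits x) r n))
      = expectation (\<lambda>x. g1 (bits x) * of_bool (\<forall>y\<in>K (bits x). b y x \<longleftrightarrow> y \<in> T (bits x)))"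
    by (intro Bochner_Integration.integral_cong refl) (auto simp: forced_def g1_def K_def T_def)
  also have "\<dots> = expectation (\<lambda>x. g1 (bits x) * (1/2) ^ card (K (bits x)))"
    by (rule expectation_conditional'[OF finite_nodes nodes g1 K finK subK T])
  also have "\<dots> = (1/2) ^ card (nodes k) * expectation (\<lambda>x. g1 (bits x) * (1/2) ^ card (kids (bits x) r n))"
    unfolding cardK by simp
  also have "expectation (\<lambda>x. g1 (bits x) * (1/2) ^ card (kids (bits x) r n))
      = expectation (\<lambda>x. g1 (bits x) * of_bool (\<forall>y\<in>kids (bits x) r n. b y x \<longleftrightarrow> y \<in> {}))"
    by (rule expectation_conditional'[OF finite_nodes nodes g1 kids_depends_on finite_kids subkids depends_on_const, symmetric])
  also have "\<dots> = expectation (\<lambda>x. g (bits x) * of_bool (reset (bits x) r n))"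
    by (intro Bochner_Integration.integral_cong refl) (auto simp: reset_def g1_def)
  finally show ?thesis .
qed

text \<open>Whether \<open>forced\<close> holds at level \<open>n\<close> is only known at level \<open>n + k + 1\<close>, so the martingale argument
  is run separately along each progression of step \<open>k + 1\<close>.\<close>

lemma AE_forced:
  "AE x in M. \<forall>r\<in>\<rat>. \<forall>n0. infinite {n. reset (bits x) r n} \<longrightarrow> (\<exists>n\<ge>n0. forced k (bits x) r n)"
proof -
  define t where "t N i = N + i * Suc k" for N i
  have "AE x in M. infinite {i. reset (bits x) r (t N i)} \<longrightarrow> (\<exists>i. forced k (bits x) r (t N i))" for r N
  proof (rule AE_infinite_imp_occurs[where A = "\<lambda>i. nodes (t N i)" and \<delta> = "(1/2) ^ card (nodes k)"])
    show "depends_on (nodes (t N (Suc i))) (\<lambda>c. reset c r (t N i))" for i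
      by (rule depends_on_mono[OF reset_depends_on nodes_mono]) (simp add: t_def)
    show "depends_on (nodes (t N (Suc i))) (\<lambda>c. forced k c r (t N i))" for i
      by (rule depends_on_mono[OF forced_depends_on nodes_mono]) (simp add: t_def)
    show "nodes (t N i) \<subseteq> nodes (t N (Suc i))" for i by (rule nodes_mono) (simp add: t_def)
    show "nodes (t N i) \<subseteq> {v. v \<noteq> []}" for i by (auto simp: nodes_def)
  qed (use reset_forced_disjoint expectation_forced in auto)
  hence "AE x in M. \<forall>r\<in>\<rat>. \<forall>N. infinite {i. reset (bits x) r (t N i)} \<longrightarrow> (\<exists>i. forced k (bits x) r (t N i))"
    by (intro AE_ball_countable[THEN iffD2] countable_rat ballI AE_all_countable[THEN iffD2] allI)
  thus ?thesis
  proof (rule AE_mp, intro AE_I2 impI ballI allI)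
    fix x r n0
    assume *: "\<forall>r\<in>\<rat>. \<forall>N. infinite {i. reset (bits x) r (t N i)} \<longrightarrow> (\<exists>i. forced k (bits x) r (t N i))"
      and r: "r \<in> \<rat>" and inf: "infinite {n. reset (bits x) r n}"
    \<comment> \<open>The progressions starting at \<open>n0\<close>, ..., \<open>n0 + k\<close>
      cover all levels from \<open>n0\<close> on, so one of them contains infinitely many
      resets.\<close>
    have "\<exists>N\<ge>n0. infinite {i. reset (bits x) r (t N i)}"
    proof (rule ccontr)
      assume "\<not> ?thesis"
      hence "finite (\<Union>N\<in>{n0..n0 + k}. t N ` {i. reset (bits x) r (t N i)})" by auto
      moreover have "{n. reset (bits x) r n} \<subseteq> {..<n0} \<union> (\<Union>N\<in>{n0..n0 + k}. t N ` {i. reset (bits x) r (t N i)})"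
      proof
        fix n assume n: "n \<in> {n. reset (bits x) r n}"
        show "n \<in> {..<n0} \<union> (\<Union>N\<in>{n0..n0 + k}. t N ` {i. reset (bits x) r (t N i)})"
        proof (cases "n < n0")
          case False
          define N where "N = n0 + (n - n0) mod Suc k"
          have "(n - n0) mod Suc k + (n - n0) div Suc k * Suc k = n - n0" by (rule mod_div_mult_eq)
          hence tn: "t N ((n - n0) div Suc k) = n" using False by (simp only: t_def N_def)
          have "(n - n0) mod Suc k < Suc k" by (rule mod_less_divisor) simp
          hence "N \<in> {n0..n0 + k}" by (simp add: N_def)
          moreover have "n \<in> t N ` {i. reset (bits x) r (t N i)}"
            using tn n by (intro image_eqI[of _ _ "(n - n0) div Suc k"]) auto
          ultimately show ?thesis by blast
        qed simp
      qed
      ultimately show False using inf by (meson finite_Un finite_lessThan finite_subset)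
    qed
    then obtain N i where "N \<ge> n0" "forced k (bits x) r (t N i)" using * r by blast
    thus "\<exists>n\<ge>n0. forced k (bits x) r n" by (intro exI[of _ "t N i"]) (auto simp: t_def)
  qed
qed

end

section \<open>Separation for digit sums and the conclusion for the random attractor\<close>

text \<open>Multiplied by \<open>\<theta> ^ n\<close>, a difference of digit sums is the value at
  \<theta> of an integer polynomial with coefficients -1, 0 and 1.\<close>

lemma pisot_digit_sum_separation:
  assumes "pisot \<theta>"
  obtains sep where "sep > 0" "\<And>c n u v. length u = n \<Longrightarrow> length v = n \<Longrightarrow> pos (1/\<theta>) c u < pos (1/\<theta>) c v \<Longrightarrow>
      pos (1/\<theta>) c u + sep * (1/\<theta>) ^ n \<le> pos (1/\<theta>) c v"
proof -
  have th: "\<theta> > 1" using assms by (simp add: pisot_def)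
  obtain \<epsilon> where \<epsilon>: "\<epsilon> > 0" "\<And>P :: int poly. (\<And>i. \<bar>coeff P i\<bar> \<le> 1) \<Longrightarrow> poly (map_poly of_int P) \<theta> \<noteq> 0
    \<Longrightarrow> \<bar>poly (map_poly of_int P) \<theta>\<bar> \<ge> \<epsilon>" using pisot_separation[OF assms] by metis
  have "pos (1/\<theta>) c u + \<epsilon> * (1/\<theta>) ^ n \<le> pos (1/\<theta>) c v"
    if len: "length u = n" "length v = n" and less: "pos (1/\<theta>) c u < pos (1/\<theta>) c v" for c n u v
  proof -
    define e :: "nat \<Rightarrow> int" where "e j = of_bool (c (take (Suc j) v)) - of_bool (c (take (Suc j) u))" for j
    \<comment> \<open>The order is reversed: the digit of index \<open>j\<close> has weight
      \<open>(1/\<theta>) ^ Suc j\<close>, hence \<open>\<theta> ^ (n - Suc j)\<close> after the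
      multiplication.\<close>
    define P where "P = (\<Sum>i<n. monom (e (n - Suc i)) i)"
    have "coeff P i = (if i < n then e (n - Suc i) else 0)" for i
      by (simp add: P_def coeff_sum)
    hence cf: "\<bar>coeff P i\<bar> \<le> 1" for i by (auto simp: e_def)
    have "map_poly of_int (\<Sum>i\<in>I. monom (e (n - Suc i)) i) = (\<Sum>i\<in>I. monom (of_int (e (n - Suc i)) :: real) i)"
      if "finite I" for I
      using that by (induction rule: finite_induct) (simp_all add: map_poly_of_int_add map_poly_monom)
    hence "poly (map_poly of_int P) \<theta> = (\<Sum>i<n. of_int (e (n - Suc i)) * \<theta> ^ i)"
      by (simp add: P_def poly_sum poly_monom)
    also have "\<dots> = (\<Sum>i<n. of_int (e (n - Suc i)) * \<theta> ^ (n - Suc (n - Suc i)))"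
      by (intro sum.cong) auto
    also have "\<dots> = (\<Sum>j<n. of_int (e j) * \<theta> ^ (n - Suc j))"
      by (rule sum.nat_diff_reindex[of "\<lambda>j. of_int (e j) * \<theta> ^ (n - Suc j)"])
    also have "\<dots> = (\<Sum>j<n. \<theta> ^ n * (of_int (e j) * (1/\<theta>) ^ Suc j))"
    proof (intro sum.cong refl)
      fix j assume "j \<in> {..<n}"
      hence "\<theta> ^ n = \<theta> ^ (n - Suc j) * \<theta> ^ Suc j" by (simp flip: power_add del: power_Suc)
      thus "of_int (e j) * \<theta> ^ (n - Suc j) = \<theta> ^ n * (of_int (e j) * (1/\<theta>) ^ Suc j)"
        using th by (simp add: power_divide del: power_Suc)
    qed
    also have "\<dots> = \<theta> ^ n * (pos (1/\<theta>) c v - pos (1/\<theta>) c u)"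
      by (simp only: pos_def len e_def of_int_diff of_int_of_bool left_diff_distrib right_diff_distrib sum_subtractf sum_distrib_left)
    finally have P: "poly (map_poly of_int P) \<theta> = \<theta> ^ n * (pos (1/\<theta>) c v - pos (1/\<theta>) c u)" .
    define d where "d = pos (1/\<theta>) c v - pos (1/\<theta>) c u"
    have pd: "\<theta> ^ n * d > 0" using less th by (simp add: d_def)
    have P': "poly (map_poly of_int P) \<theta> = \<theta> ^ n * d" unfolding P d_def ..
    hence "poly (map_poly of_int P) \<theta> \<noteq> 0" using pd by linarith
    hence "\<epsilon> \<le> \<bar>poly (map_poly of_int P) \<theta>\<bar>" by (rule \<epsilon>(2)[OF cf])
    hence "\<epsilon> \<le> \<theta> ^ n * d" using pd P' by linarith
    hence "\<epsilon> * (1/\<theta>) ^ n \<le> \<theta> ^ n * d * (1/\<theta>) ^ n" using th by (intro mult_right_mono) auto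
    also have "\<dots> = d" using th by (simp add: power_one_over)
    finally have "\<epsilon> * (1/\<theta>) ^ n \<le> d" .
    thus ?thesis unfolding d_def by linarith
  qed
  with \<epsilon>(1) show ?thesis using that by blast
qed

text \<open>The gaps are the components \<open>C\<close>; a finite left endpoint is
  \<open>Inf C\<close>, a finite right endpoint \<open>Sup C\<close>. Left endpoints are handled
  with the digits themselves, right endpoints with the flipped digits.\<close>

theorem theorem1p9:
  fixes M :: "'w measure" and a :: "bool list \<Rightarrow> 'w \<Rightarrow> real" and \<theta> :: real
  assumes "prob_space M"
    and "prob_space.indep_vars M (\<lambda>_. borel) a {v. v \<noteq> []}"
    and "\<And>v. v \<noteq> [] \<Longrightarrow> measure M {x \<in> space M. a v x = 0} = 1/2"
    and "\<And>v. v \<noteq> [] \<Longrightarrow> measure M {x \<in> space M. a v x = 1} = 1/2"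
    and "pisot \<theta>"
  shows "AE x in M.
     \<not> connected (attractor (\<lambda>v. a v x) (1/\<theta>)) \<and>
     (\<forall>C \<in> components (- attractor (\<lambda>v. a v x) (1/\<theta>)).
        (bdd_below C \<longrightarrow> (\<forall>\<epsilon>>0. \<not> {Inf C - \<epsilon><..<Inf C} \<subseteq> attractor (\<lambda>v. a v x) (1/\<theta>))) \<and>
        (bdd_above C \<longrightarrow> (\<forall>\<epsilon>>0. \<not> {Sup C<..<Sup C + \<epsilon>} \<subseteq> attractor (\<lambda>v. a v x) (1/\<theta>))))"
proof -
  interpret prob_space M by fact
  define lam where "lam = 1/\<theta>"
  have "\<theta> > 1" using assms(5) by (simp add: pisot_def)
  hence contr: "contraction lam" by unfold_locales (auto simp: lam_def)
  interpret contraction lam by fact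
  define b where "b = (\<lambda>v x. a v x = 1)"
  have fb: "fair_bits M {v. v \<noteq> []} b"
    unfolding b_def using fair_bits_of_indep_vars[OF assms(2)] assms(4) by simp
  interpret B: tree_bits_contraction M b lam
    by (intro tree_bits_contraction.intro tree_bits.intro fb contr)
  interpret B': tree_bits_contraction M "\<lambda>v x. \<not> b v x" lam
    by (intro tree_bits_contraction.intro tree_bits.intro fair_bits_complement fb contr)
  obtain sep where sep: "sep > 0" "\<And>c n u v. length u = n \<Longrightarrow> length v = n \<Longrightarrow> pos lam c u < pos lam c v \<Longrightarrow>
      pos lam c u + sep * lam ^ n \<le> pos lam c v"
    unfolding lam_def using pisot_digit_sum_separation[OF assms(5)] by metis
  obtain k where k: "L * lam ^ k < sep" using ex_small_power[OF sep(1)] by blast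
  have "AE x in M. a v x = 0 \<or> a v x = 1" if v: "v \<noteq> []" for v
  proof -
    have rv: "random_variable borel (a v)" using assms(2) v by (auto simp: indep_vars_def)
    have ev: "{x \<in> space M. a v x = 0} \<in> events" "{x \<in> space M. a v x = 1} \<in> events" using rv by measurable
    have "prob ({x \<in> space M. a v x = 0} \<union> {x \<in> space M. a v x = 1}) = 1"
      using assms(3,4)[OF v] ev by (subst finite_measure_Union) auto
    hence "AE x in M. x \<in> {x \<in> space M. a v x = 0} \<union> {x \<in> space M. a v x = 1}" by (rule AE_prob_1)
    thus ?thesis by eventually_elim auto
  qed
  hence "AE x in M. \<forall>v. v \<noteq> [] \<longrightarrow> a v x = 0 \<or> a v x = 1"
    by (subst AE_all_countable) (auto intro: AE_I2)
  thus ?thesis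
    using B.AE_extinct B.AE_forced[of k] B'.AE_extinct B'.AE_forced[of k]
  proof eventually_elim
    case (elim x)
    define c where "c v \<longleftrightarrow> b v x" for v
    define X where "X = attractor (\<lambda>v. a v x) (1/\<theta>)"
    have "a v x = of_bool (c v)" if "v \<noteq> []" for v
      using elim(1) that by (auto simp: c_def b_def)
    \<comment> \<open>The digits agree on nonempty words, and \<open>coding_map\<close> reads only
      nonempty prefixes.\<close>
    hence X: "X = S c"
      unfolding X_def S_def attractor_def coding_map_def lam_def[symmetric] by (simp del: upt_Suc add: upt_rec)
    have forcing: "\<exists>n\<ge>n0. forced k c r n" if "r \<in> \<rat>" "infinite {n. reset c r n}" for r n0
      using elim(3) that unfolding c_def by blast
    have forcing': "\<exists>n\<ge>n0. forced k (\<lambda>v. \<not> c v) r n" if "r \<in> \<rat>" "infinite {n. reset (\<lambda>v. \<not> c v) r n}" for r n0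
      using elim(5) that unfolding c_def by blast
    have ext: "\<exists>m. \<not> survives c m v" "\<exists>m. \<not> survives (\<lambda>v. \<not> c v) m v" for v
      using elim(2,4) unfolding c_def by blast+
    interpret F: forcing_tree lam c sep k
      by unfold_locales (fact sep(2) k ext forcing)+
    interpret F': forcing_tree lam "\<lambda>v. \<not> c v" sep k
      by unfold_locales (fact sep(2) k ext forcing')+
    have conn: "\<not> connected X" unfolding X by (rule F.S_not_connected)
    have left: "\<not> {Inf C - \<epsilon><..<Inf C} \<subseteq> X" if C: "C \<in> components (- X)" "bdd_below C" and "\<epsilon> > 0" for C \<epsilon>
    proof -
      obtain r where "Inf C \<in> X" "Inf C < r" "{Inf C<..<r} \<inter> X = {}"
        using component_Inf[OF _ C] closed_S X by metis
      thus ?thesis unfolding X using F.left_endpoint_not_isolated[OF _ _ _ \<open>\<epsilon> > 0\<close>] by blast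
    qed
    have right: "\<not> {Sup C<..<Sup C + \<epsilon>} \<subseteq> X" if C: "C \<in> components (- X)" "bdd_above C" and "\<epsilon> > 0" for C \<epsilon>
    proof -
      obtain r where r: "Sup C \<in> X" "r < Sup C" "{r<..<Sup C} \<inter> X = {}"
        using component_Sup[OF _ C] closed_S X by metis
      \<comment> \<open>The reflection \<open>y \<mapsto> L - y\<close> exchanges \<open>X\<close>
        with the attractor of the flipped digits and turns right endpoints of gaps into left
        ones.\<close>
      have mem: "y \<in> S (\<lambda>v. \<not> c v) \<longleftrightarrow> L - y \<in> X" for y
        unfolding S_complement X by force
      have "\<not> {(L - Sup C) - \<epsilon><..<L - Sup C} \<subseteq> S (\<lambda>v. \<not> c v)"
      proof (rule F'.left_endpoint_not_isolated[OF _ _ _ \<open>\<epsilon> > 0\<close>])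
        show "L - Sup C \<in> S (\<lambda>v. \<not> c v)" using r by (simp add: mem)
        show "L - Sup C < L - r" using r by simp
        show "{L - Sup C<..<L - r} \<inter> S (\<lambda>v. \<not> c v) = {}"
        proof (intro equals0I)
          fix y assume y: "y \<in> {L - Sup C<..<L - r} \<inter> S (\<lambda>v. \<not> c v)"
          hence "L - y \<in> {r<..<Sup C} \<inter> X" by (auto simp: mem)
          thus False using r(3) by blast
        qed
      qed
      then obtain y where "y \<in> {L - Sup C - \<epsilon><..<L - Sup C}" "y \<notin> S (\<lambda>v. \<not> c v)" by blast
      hence y: "L - Sup C - \<epsilon> < y" "y < L - Sup C" "L - y \<notin> X" by (simp_all add: mem)
      hence "L - y \<in> {Sup C<..<Sup C + \<epsilon>}" by auto
      thus ?thesis using y(3) by blast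
    qed
    show ?case
      unfolding X_def[symmetric] by (intro conjI ballI impI allI conn left right)
  qed
qed

end
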